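(* Let $\mathcal{H}$ be a complex Hilbert space, let $A\in\mathcal{B}(\mathcal{H})$, let $r\geq 1$ be a real number, and let $0\leq \theta\leq 1$. Then \[ w^{2r}(A)\leq \frac14\left\| |A|^{4r\theta}+|A^*|^{4r(1-\theta)}\right\| +\frac12\, w\!\left(|A|^{2r\theta}|A^*|^{2r(1-\theta)}\right). \]
   Context: $\mathcal{B}(\mathcal{H})$ is the algebra of bounded linear operators on the complex Hilbert space $\mathcal{H}$, and $\|\cdot\|$ is the operator norm. For $T\in\mathcal{B}(\mathcal{H})$, the numerical radius is $w(T)=\sup\{|\langle Tx,x\rangle| : x\in\mathcal{H},\ \|x\|=1\}$, and $w^{2r}(T)$ means $(w(T))^{2r}$. $|T|=(T^*T)^{1/2}$, so $|T^*|=(TT^* )^{1/2}$. Real nonnegative powers of positive operators are taken via the continuous functional calculus, with $P^0=I$. *)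

theory Defs
  imports "HOL-Analysis.Analysis" "HOL-Computational_Algebra.Polynomial"
begin

text \<open>Complex Hilbert spaces. The inner product is linear in its first argument.\<close>

class complex_inner = real_normed_vector +
  fixes scaleC :: "complex \<Rightarrow> 'a \<Rightarrow> 'a" (infixr "*\<^sub>C" 75)
    and cinner :: "'a \<Rightarrow> 'a \<Rightarrow> complex"
  assumes scaleC_add_right: "c *\<^sub>C (x + y) = c *\<^sub>C x + c *\<^sub>C y"
    and scaleC_add_left: "(c + d) *\<^sub>C x = c *\<^sub>C x + d *\<^sub>C x"
    and scaleC_scaleC: "c *\<^sub>C d *\<^sub>C x = (c * d) *\<^sub>C x"
    and scaleR_eq_scaleC: "t *\<^sub>R x = complex_of_real t *\<^sub>C x"
    and cinner_commute: "cinner x y = cnj (cinner y x)"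
    and cinner_add_left: "cinner (x + y) z = cinner x z + cinner y z"
    and cinner_scaleC_left: "cinner (c *\<^sub>C x) y = c * cinner x y"
    and cinner_self_eq_norm: "cinner x x = complex_of_real ((norm x)\<^sup>2)"

class chilbert_space = complex_inner + complete_space

instantiation complex :: chilbert_space
begin

definition scaleC_complex :: "complex \<Rightarrow> complex \<Rightarrow> complex"
  where "scaleC_complex c x = c * x"

definition cinner_complex :: "complex \<Rightarrow> complex \<Rightarrow> complex"
  where "cinner_complex x y = x * cnj y"

instance
  by standard
    (auto simp: scaleC_complex_def cinner_complex_def algebra_simps scaleR_conv_of_real
      complex_norm_square simp flip: of_real_power)

end

text \<open>
  The type \<open>'a \<Rightarrow>\<^sub>L 'a\<close> consists of the bounded \<^emph>\<open>real\<close>-linear operators, with the operator norm;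
  the complex-linear ones among them form the algebra of bounded operators on the complex
  Hilbert space.
\<close>

definition is_clinear :: "('a::complex_inner \<Rightarrow>\<^sub>L 'a) \<Rightarrow> bool"
  where "is_clinear T \<longleftrightarrow> (\<forall>c x. T (c *\<^sub>C x) = c *\<^sub>C T x)"

definition adjoint_op :: "('a::chilbert_space \<Rightarrow>\<^sub>L 'a) \<Rightarrow> ('a \<Rightarrow>\<^sub>L 'a)"
  where "adjoint_op T = (THE S :: 'a \<Rightarrow>\<^sub>L 'a. \<forall>x y. cinner (T x) y = cinner x (S y))"

text \<open>
  Inserting \<open>0\<close> does not change the supremum of a nonempty set of moduli; it makes the numerical
  radius \<open>0\<close> on the zero space, where there are no unit vectors.
\<close>

definition numerical_radius :: "('a::complex_inner \<Rightarrow>\<^sub>L 'a) \<Rightarrow> real"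
  where "numerical_radius T = Sup (insert 0 {cmod (cinner (T x) x) | x. norm x = 1})"

definition op_spectrum :: "('a::complex_inner \<Rightarrow>\<^sub>L 'a) \<Rightarrow> complex set"
  where "op_spectrum T = {z. \<not> (\<exists>S :: 'a \<Rightarrow>\<^sub>L 'a. is_clinear S \<and>
    (\<forall>x. S (T x - z *\<^sub>C x) = x) \<and> (\<forall>x. T (S x) - z *\<^sub>C S x = x))}"

definition poly_op :: "real poly \<Rightarrow> ('a::real_normed_vector \<Rightarrow>\<^sub>L 'a) \<Rightarrow> ('a \<Rightarrow>\<^sub>L 'a)"
  where "poly_op p T = (\<Sum>i\<le>degree p. coeff p i *\<^sub>R (((o\<^sub>L) T) ^^ i) id_blinfun)"

text \<open>
  Continuous functional calculus \<open>f(T)\<close> of a self-adjoint \<open>T\<close>, whose spectrum is real, for a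
  real-valued \<open>f\<close> that is continuous on the spectrum: the common norm limit of \<open>p\<^sub>n(T)\<close> over all
  sequences of polynomials \<open>p\<^sub>n\<close> converging to \<open>f\<close> uniformly on the spectrum.
\<close>

definition cont_fun_calc ::
    "(real \<Rightarrow> real) \<Rightarrow> ('a::chilbert_space \<Rightarrow>\<^sub>L 'a) \<Rightarrow> ('a \<Rightarrow>\<^sub>L 'a)"
  where "cont_fun_calc f T = (THE S. \<forall>p :: nat \<Rightarrow> real poly.
    uniform_limit {t. complex_of_real t \<in> op_spectrum T} (\<lambda>n. poly (p n)) f sequentially
      \<longrightarrow> (\<lambda>n. poly_op (p n) T) \<longlonglongrightarrow> S)"

text \<open>
  The case distinction gives \<open>P\<^sup>0 = I\<close>, since \<open>0 powr 0 = 0\<close> in the library.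
  The definition is meant for positive \<open>P\<close> and \<open>a \<ge> 0\<close>.
\<close>

definition op_powr :: "('a::chilbert_space \<Rightarrow>\<^sub>L 'a) \<Rightarrow> real \<Rightarrow> ('a \<Rightarrow>\<^sub>L 'a)"
  where "op_powr P a = cont_fun_calc (\<lambda>t. if a = 0 then 1 else t powr a) P"

definition op_abs :: "('a::chilbert_space \<Rightarrow>\<^sub>L 'a) \<Rightarrow> ('a \<Rightarrow>\<^sub>L 'a)"
  where "op_abs T = op_powr (adjoint_op T o\<^sub>L T) (1 / 2)"

end

theory Submission
  imports Defs "HOL-Computational_Algebra.Fundamental_Theorem_Algebra"
begin

text \<open>
  Write \<open>B = |A|\<close> and \<open>C = |A\<^sup>*|\<close> and let \<open>x\<close> be a unit vector. The mixed Schwarz inequality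
  (\<open>mixed_Schwarz\<close>) bounds \<open>|\<langle>A x, x\<rangle>|\<^sup>2\<close> by the product of \<open>\<langle>B powr (2 \<theta>) x, x\<rangle>\<close> and
  \<open>\<langle>C powr (2 (1 - \<theta>)) x, x\<rangle>\<close>. Since \<open>r \<ge> 1\<close>, raising both factors to the power \<open>r\<close> can be
  absorbed into the operators (\<open>McCarthy_inequality\<close>), and the bound becomes
  \<open>\<langle>a, x\<rangle> \<langle>x, b\<rangle>\<close> with \<open>a = B powr (2 r \<theta>) x\<close> and \<open>b = C powr (2 r (1 - \<theta>)) x\<close>. Buzano's
  refinement of the Schwarz inequality (\<open>Buzano_inequality\<close>) bounds this by half of
  \<open>norm a * norm b + |\<langle>a, b\<rangle>|\<close>. The first term is at most half of
  \<open>(norm a)\<^sup>2 + (norm b)\<^sup>2\<close>, which is the quadratic form of the sum of operators in the theorem;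
  the second is a value of the quadratic form of the product whose numerical radius appears there.

  The inequalities rest on the functional calculus of a positive operator \<open>T\<close>, which has to be
  shown to exist. The point is that \<open>norm (p(T))\<close> is a value of \<open>|p|\<close> on the spectrum
  (\<open>norm_poly_op_attained\<close>): with \<open>N = norm (p(T))\<close>, the operator \<open>p(T)\<^sup>2 - N\<^sup>2\<close> has arbitrarily
  small values on unit vectors, hence so has one of the linear factors \<open>T - z\<close> of \<open>p\<^sup>2 - N\<^sup>2\<close>,
  and this \<open>z\<close> is a real point of the spectrum. As the spectrum lies in \<open>[0, norm T]\<close>
  (\<open>positive_op_spectrum\<close>), Weierstrass approximation then gives \<open>f(T)\<close> for every \<open>f\<close> continuous
  on \<open>[0, \<infinity>)\<close>.

  The mixed Schwarz inequality is derived from the intertwining relation \<open>A f(B) = f(C) A\<close>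
  (\<open>cont_fun_calc_intertwine\<close>): a function of \<open>B\<close> applied to the first argument of
  \<open>\<langle>A x, y\<rangle>\<close> can be traded for a function of \<open>C\<close> applied to the second.
\<close>

section \<open>Complex inner products\<close>

instance chilbert_space \<subseteq> banach ..

lemma cinner_add_right: "cinner x (y + z) = cinner x y + cinner x z"
  using cinner_add_left[of y z x] cinner_commute[of x "y + z"] cinner_commute[of x y]
    cinner_commute[of x z]
  by simp

lemma cinner_scaleC_right: "cinner x (c *\<^sub>C y) = cnj c * cinner x y"
  using cinner_scaleC_left[of c y x] cinner_commute[of x "c *\<^sub>C y"] cinner_commute[of x y]
  by simp

lemma cinner_scaleR_left: "cinner (t *\<^sub>R x) y = complex_of_real t * cinner x y"
  by (simp add: scaleR_eq_scaleC cinner_scaleC_left)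

lemma cinner_scaleR_right: "cinner x (t *\<^sub>R y) = complex_of_real t * cinner x y"
  by (simp add: scaleR_eq_scaleC cinner_scaleC_right)

lemma cinner_minus_left: "cinner (- x) y = - cinner x y"
  using cinner_scaleR_left[of "- 1" x y] by simp

lemma cinner_minus_right: "cinner x (- y) = - cinner x y"
  using cinner_scaleR_right[of x "- 1" y] by simp

lemma cinner_diff_left: "cinner (x - y) z = cinner x z - cinner y z"
  using cinner_add_left[of x "- y" z] by (simp add: cinner_minus_left)

lemma cinner_diff_right: "cinner x (y - z) = cinner x y - cinner x z"
  using cinner_add_right[of x y "- z"] by (simp add: cinner_minus_right)

lemmas cinner_algebra =
  cinner_add_left cinner_add_right cinner_diff_left cinner_diff_right
  cinner_scaleC_left cinner_scaleC_right cinner_scaleR_left cinner_scaleR_right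
  cinner_minus_left cinner_minus_right

lemma cinner_zero_left [simp]: "cinner 0 x = 0"
  using cinner_scaleR_left[of 0 x x] by simp

lemma cinner_zero_right [simp]: "cinner x 0 = 0"
  using cinner_scaleR_right[of x 0 x] by simp

lemma Re_cinner_commute: "Re (cinner x y) = Re (cinner y x)"
  by (subst cinner_commute) simp

lemma norm_sq_cinner: "(norm x)\<^sup>2 = Re (cinner x x)"
  by (simp add: cinner_self_eq_norm)

lemma norm_add_sq: "(norm (x + y))\<^sup>2 = (norm x)\<^sup>2 + 2 * Re (cinner x y) + (norm y)\<^sup>2"
  for x y :: "'a::complex_inner"
  using Re_cinner_commute[of x y] by (simp add: norm_sq_cinner cinner_algebra)

lemma norm_diff_sq: "(norm (x - y))\<^sup>2 = (norm x)\<^sup>2 - 2 * Re (cinner x y) + (norm y)\<^sup>2"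
  for x y :: "'a::complex_inner"
  using Re_cinner_commute[of x y] by (simp add: norm_sq_cinner cinner_algebra)

lemma norm_scaleC: "norm (c *\<^sub>C x) = cmod c * norm x"
proof -
  have "complex_of_real ((norm (c *\<^sub>C x))\<^sup>2) = c * cnj c * complex_of_real ((norm x)\<^sup>2)"
    unfolding cinner_self_eq_norm[symmetric] by (simp add: cinner_algebra)
  also have "\<dots> = complex_of_real ((cmod c * norm x)\<^sup>2)"
    by (simp only: complex_norm_square[symmetric] power_mult_distrib of_real_mult)
  finally have "complex_of_real ((norm (c *\<^sub>C x))\<^sup>2) = complex_of_real ((cmod c * norm x)\<^sup>2)" .
  then have "(norm (c *\<^sub>C x))\<^sup>2 = (cmod c * norm x)\<^sup>2"
    by (simp only: of_real_eq_iff)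
  then show ?thesis
    by (simp add: power2_eq_iff_nonneg)
qed

lemma scaleC_one [simp]: "1 *\<^sub>C x = x"
  using scaleR_eq_scaleC[of 1 x] by simp

lemma scaleC_zero_left [simp]: "0 *\<^sub>C x = 0"
  using scaleR_eq_scaleC[of 0 x] by simp

lemma scaleC_zero_right [simp]: "c *\<^sub>C 0 = 0"
  using norm_scaleC[of c 0] by simp

lemma scaleC_minus_left: "(- c) *\<^sub>C x = - (c *\<^sub>C x)"
  using scaleC_add_left[of c "- c" x] by (simp add: add_eq_0_iff)

lemma scaleC_minus_right: "c *\<^sub>C (- x) = - (c *\<^sub>C x)"
  using scaleC_add_right[of c x "- x"] by (simp add: add_eq_0_iff)

lemma scaleC_diff_right: "c *\<^sub>C (x - y) = c *\<^sub>C x - c *\<^sub>C y"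
  using scaleC_add_right[of c x "- y"] by (simp add: scaleC_minus_right)

lemma Cauchy_Schwarz_cinner: "cmod (cinner x y) \<le> norm x * norm y"
proof (cases "y = 0")
  case False
  define c where "c = cinner x y / complex_of_real ((norm y)\<^sup>2)"
  have y: "(norm y)\<^sup>2 > 0"
    using False by simp
  have "cinner x (c *\<^sub>C y) = cinner x y * cnj (cinner x y) / complex_of_real ((norm y)\<^sup>2)"
    by (simp add: c_def cinner_algebra)
  then have "Re (cinner x (c *\<^sub>C y)) = (cmod (cinner x y))\<^sup>2 / (norm y)\<^sup>2"
    by (simp only: complex_norm_square[symmetric] of_real_divide[symmetric] Re_complex_of_real)
  moreover have "(norm (c *\<^sub>C y))\<^sup>2 = (cmod (cinner x y))\<^sup>2 / (norm y)\<^sup>2"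
    unfolding norm_scaleC c_def norm_divide norm_of_real abs_power2
    using y by (simp add: power_mult_distrib power_divide power2_eq_square)
  ultimately have "(norm (x - c *\<^sub>C y))\<^sup>2 = (norm x)\<^sup>2 - (cmod (cinner x y))\<^sup>2 / (norm y)\<^sup>2"
    by (simp add: norm_diff_sq)
  then have "(cmod (cinner x y))\<^sup>2 / (norm y)\<^sup>2 \<le> (norm x)\<^sup>2"
    using zero_le_power2[of "norm (x - c *\<^sub>C y)"] by argo
  then have "(cmod (cinner x y))\<^sup>2 \<le> (norm x * norm y)\<^sup>2"
    using y by (simp add: divide_simps power_mult_distrib)
  then show ?thesis
    by (simp add: abs_le_square_iff[symmetric])
qed simp

lemma bounded_bilinear_cinner: "bounded_bilinear cinner"
  by unfold_locales
    (auto simp: cinner_algebra scaleR_conv_of_real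
      intro!: exI[of _ 1] order_trans[OF Cauchy_Schwarz_cinner])

lemmas tendsto_cinner = bounded_bilinear.tendsto[OF bounded_bilinear_cinner]

lemma cinner_right_eqI:
  assumes "\<And>x. cinner x y = cinner x z"
  shows "y = z"
proof -
  have "cinner (y - z) (y - z) = 0"
    using assms by (simp add: cinner_diff_right)
  then show ?thesis
    by (simp add: cinner_self_eq_norm)
qed

text \<open>
  The vector \<open>2 \<langle>a, e\<rangle> e - a\<close> is the mirror image of \<open>a\<close> in the line spanned by \<open>e\<close>. It has the
  norm of \<open>a\<close>, and its inner product with \<open>b\<close> is \<open>2 \<langle>a, e\<rangle> \<langle>e, b\<rangle> - \<langle>a, b\<rangle>\<close>.
\<close>

lemma Buzano_inequality:
  assumes "norm e = 1"
  shows "cmod (cinner a e) * cmod (cinner e b) \<le> (norm a * norm b + cmod (cinner a b)) / 2"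
proof -
  define a' where "a' = (2 * cinner a e) *\<^sub>C e - a"
  have ee: "cinner e e = 1"
    using assms by (simp add: cinner_self_eq_norm)
  have "cinner e a = cnj (cinner a e)"
    by (rule cinner_commute)
  then have "cinner a' a' = cinner a a"
    by (simp add: a'_def cinner_algebra ee)
  then have "norm a' = norm a"
    by (metis norm_sq_cinner norm_ge_zero power2_eq_imp_eq)
  have "2 * (cinner a e * cinner e b) = cinner a' b + cinner a b"
    by (simp add: a'_def cinner_algebra)
  then have "2 * (cmod (cinner a e) * cmod (cinner e b)) = cmod (cinner a' b + cinner a b)"
    by (metis norm_mult norm_numeral)
  also have "\<dots> \<le> norm a' * norm b + cmod (cinner a b)"
    by (rule order_trans[OF norm_triangle_ineq add_right_mono[OF Cauchy_Schwarz_cinner]])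
  finally show ?thesis
    using \<open>norm a' = norm a\<close> by simp
qed

section \<open>Adjoints\<close>

text \<open>
  The representing vector minimises \<open>(norm x)\<^sup>2 - 2 f x\<close>: by the parallelogram law, minimising
  sequences are Cauchy, and at a minimum all directional derivatives \<open>2 (Re \<langle>v, z\<rangle> - f v)\<close> vanish.
\<close>

lemma Riesz_representation_Re:
  fixes f :: "'a::chilbert_space \<Rightarrow> real"
  assumes "bounded_linear f"
  obtains z where "\<And>x. f x = Re (cinner x z)"
proof -
  interpret f: bounded_linear f by fact
  define J where "J x = (norm x)\<^sup>2 - 2 * f x" for x
  obtain K where K: "\<And>x. norm (f x) \<le> norm x * K"
    using f.bounded by blast
  have J_ge: "- K\<^sup>2 \<le> J x" for x
  proof -
    have "f x \<le> norm x * K"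
      using K[of x] by simp
    moreover have "0 \<le> (norm x - K)\<^sup>2"
      by simp
    ultimately show ?thesis
      by (simp add: J_def power2_diff)
  qed
  define m where "m = Inf (range J)"
  have bdd: "bdd_below (range J)"
    using J_ge by (intro bdd_belowI[of _ "- K\<^sup>2"]) auto
  have m_le: "m \<le> J x" for x
    unfolding m_def by (rule cInf_lower[OF _ bdd]) simp
  have "\<exists>x. J x < m + 1 / real (Suc n)" for n
    using cInf_lessD[of "range J" "m + 1 / real (Suc n)"] by (auto simp: m_def)
  then obtain X where X: "\<And>n. J (X n) < m + 1 / real (Suc n)"
    by metis
  have dist_sq: "(norm (x - y))\<^sup>2 \<le> 2 * (J x - m) + 2 * (J y - m)" for x y
  proof -
    have "J ((1/2) *\<^sub>R (x + y)) = (norm (x + y))\<^sup>2 / 4 - (f x + f y)"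
      unfolding J_def norm_scaleR f.scaleR f.add power_mult_distrib
      by (simp add: power2_eq_square field_simps)
    then have "(norm (x - y))\<^sup>2 = 2 * J x + 2 * J y - 4 * J ((1/2) *\<^sub>R (x + y))"
      unfolding J_def[of x] J_def[of y] using norm_add_sq[of x y] norm_diff_sq[of x y] by argo
    then show ?thesis
      using m_le[of "(1/2) *\<^sub>R (x + y)"] by argo
  qed
  have "Cauchy X"
  proof (rule metric_CauchyI)
    fix e :: real
    assume "e > 0"
    then obtain N where N: "1 / real (Suc N) < e\<^sup>2 / 4"
      using reals_Archimedean[of "e\<^sup>2 / 4"] by (auto simp: inverse_eq_divide)
    have "dist (X i) (X j) < e" if "i \<ge> N" "j \<ge> N" for i j
    proof -
      have J_lt: "J (X k) - m < e\<^sup>2 / 4" if "k \<ge> N" for k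
      proof -
        have "1 / real (Suc k) \<le> 1 / real (Suc N)"
          using that by (simp add: frac_le)
        then show ?thesis
          using X[of k] N by argo
      qed
      have "(norm (X i - X j))\<^sup>2 < e\<^sup>2"
        using dist_sq[of "X i" "X j"] J_lt[OF that(1)] J_lt[OF that(2)] by argo
      then show ?thesis
        using \<open>e > 0\<close> by (auto simp: dist_norm intro: power2_less_imp_less)
    qed
    then show "\<exists>N. \<forall>i\<ge>N. \<forall>j\<ge>N. dist (X i) (X j) < e"
      by blast
  qed
  then obtain z where z: "X \<longlonglongrightarrow> z"
    by (auto simp: Cauchy_convergent_iff convergent_def)
  have "(\<lambda>n. J (X n)) \<longlonglongrightarrow> J z"
    unfolding J_def by (intro tendsto_intros z f.tendsto)
  moreover have "(\<lambda>n. m + 1 / real (Suc n)) \<longlonglongrightarrow> m + 0"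
    by (intro tendsto_intros LIMSEQ_Suc lim_1_over_n)
  ultimately have Jz: "J z \<le> m"
    using LIMSEQ_le[of "\<lambda>n. J (X n)" "J z" "\<lambda>n. m + 1 / real (Suc n)" m] X
    by (auto intro: less_imp_le)
  have "f v = Re (cinner v z)" for v
  proof -
    define b where "b = Re (cinner v z) - f v"
    define d where "d = (norm v)\<^sup>2 + 1"
    have "d > 0"
      by (simp add: d_def add_nonneg_pos)
    \<comment> \<open>the minimiser of \<open>2 * t * b + t\<^sup>2 * d\<close>, an upper bound for the increment of \<open>J\<close>\<close>
    define t where "t = - b / d"
    have "J z \<le> J (z + t *\<^sub>R v)"
      using Jz m_le order_trans by blast
    also have "\<dots> = J z + (2 * t * b + t\<^sup>2 * (norm v)\<^sup>2)"
      using Re_cinner_commute[of z v]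
      by (simp add: J_def norm_add_sq f.add f.scaleR cinner_algebra b_def power_mult_distrib
          algebra_simps)
    also have "2 * t * b + t\<^sup>2 * (norm v)\<^sup>2 \<le> 2 * t * b + t\<^sup>2 * d"
      by (simp add: d_def mult_left_mono)
    also have "\<dots> = - (b\<^sup>2 / d)"
      using \<open>d > 0\<close> by (simp add: t_def field_simps power2_eq_square)
    finally have "b\<^sup>2 / d \<le> 0"
      by simp
    then show ?thesis
      using \<open>d > 0\<close> by (simp add: b_def divide_le_0_iff)
  qed
  then show thesis
    by (rule that)
qed

text \<open>
  Representing the real parts of \<open>\<langle>T x, y\<rangle>\<close> is enough: complex linearity of \<open>T\<close>, applied to \<open>\<i> x\<close>,
  recovers the imaginary parts.
\<close>

lemma adjoint_exists:
  fixes T :: "'a::chilbert_space \<Rightarrow>\<^sub>L 'a"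
  assumes "is_clinear T"
  obtains S :: "'a \<Rightarrow>\<^sub>L 'a" where "\<And>x y. cinner (T x) y = cinner x (S y)"
proof -
  have "\<exists>z. \<forall>x. cinner (T x) y = cinner x z" for y
  proof -
    have "bounded_linear (\<lambda>x. Re (cinner (T x) y))"
      by (rule bounded_linear_compose[OF bounded_linear_Re bounded_linear_compose[OF
            bounded_bilinear.bounded_linear_left[OF bounded_bilinear_cinner]
            blinfun.bounded_linear_right]])
    then obtain z where z: "\<And>x. Re (cinner (T x) y) = Re (cinner x z)"
      by (rule Riesz_representation_Re) (rule that)
    have "cinner (T x) y = cinner x z" for x
      using z[of x] z[of "\<i> *\<^sub>C x"] assms
      by (auto simp: is_clinear_def cinner_algebra intro: complex_eqI)
    then show ?thesis by blast
  qed
  then obtain S where S: "\<And>x y. cinner (T x) y = cinner x (S y)"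
    by metis
  have "bounded_linear S"
  proof (rule bounded_linear_intro)
    show "S (x + y) = S x + S y" for x y
      by (rule cinner_right_eqI) (simp add: cinner_add_right S[symmetric])
    show "S (t *\<^sub>R x) = t *\<^sub>R S x" for t x
      by (rule cinner_right_eqI) (simp add: cinner_scaleR_right S[symmetric])
    show "norm (S y) \<le> norm y * norm T" for y
    proof -
      have "(norm (S y))\<^sup>2 = Re (cinner (T (S y)) y)"
        by (simp add: norm_sq_cinner S)
      also have "\<dots> \<le> norm (T (S y)) * norm y"
        using complex_Re_le_cmod Cauchy_Schwarz_cinner order_trans by blast
      also have "\<dots> \<le> (norm T * norm (S y)) * norm y"
        by (intro mult_right_mono norm_blinfun) simp
      finally have "norm (S y) * norm (S y) \<le> norm (S y) * (norm y * norm T)"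
        by (simp add: power2_eq_square mult_ac)
      then show ?thesis
        by (cases "S y = 0") auto
    qed
  qed
  then show thesis
    using that[of "Blinfun S"] by (simp add: S bounded_linear_Blinfun_apply)
qed

lemma adjoint_unique:
  fixes T S :: "'a::chilbert_space \<Rightarrow>\<^sub>L 'a"
  assumes "\<And>x y. cinner (T x) y = cinner x (S y)"
  shows "adjoint_op T = S"
  unfolding adjoint_op_def
proof (rule the_equality)
  show "\<forall>x y. cinner (T x) y = cinner x (S y)"
    using assms by blast
  fix S' :: "'a \<Rightarrow>\<^sub>L 'a"
  assume "\<forall>x y. cinner (T x) y = cinner x (S' y)"
  then have "cinner x (S' y) = cinner x (S y)" for x y
    using assms by metis
  then show "S' = S"
    by (metis blinfun_eqI cinner_right_eqI)
qed

lemma cinner_adjoint: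
  assumes "is_clinear T"
  shows "cinner (T x) y = cinner x (adjoint_op T y)"
  using adjoint_exists[OF assms] adjoint_unique by metis

lemma cinner_adjoint':
  assumes "is_clinear T"
  shows "cinner (adjoint_op T x) y = cinner x (T y)"
  using cinner_adjoint[OF assms, of y x] by (metis cinner_commute)

lemma is_clinear_adjoint:
  assumes "is_clinear T"
  shows "is_clinear (adjoint_op T)"
  unfolding is_clinear_def
proof (intro allI)
  show "adjoint_op T (c *\<^sub>C x) = c *\<^sub>C adjoint_op T x" for c x
    by (rule cinner_right_eqI) (simp add: cinner_algebra cinner_adjoint[OF assms, symmetric])
qed

lemma adjoint_adjoint:
  assumes "is_clinear T"
  shows "adjoint_op (adjoint_op T) = T"
  by (rule adjoint_unique) (rule cinner_adjoint'[OF assms])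

section \<open>Self-adjoint operators\<close>

definition selfadjoint :: "('a::complex_inner \<Rightarrow>\<^sub>L 'a) \<Rightarrow> bool"
  where "selfadjoint T \<longleftrightarrow> (\<forall>x y. cinner (T x) y = cinner x (T y))"

lemma selfadjointD: "selfadjoint T \<Longrightarrow> cinner (T x) y = cinner x (T y)"
  by (simp add: selfadjoint_def)

lemma selfadjoint_is_clinear:
  assumes "selfadjoint T"
  shows "is_clinear T"
  unfolding is_clinear_def
proof (intro allI)
  show "T (c *\<^sub>C x) = c *\<^sub>C T x" for c x
    by (rule cinner_right_eqI) (simp add: cinner_algebra selfadjointD[OF assms, symmetric])
qed

lemma selfadjoint_Im_eq_0:
  assumes "selfadjoint T"
  shows "Im (cinner (T x) x) = 0"
proof -
  have "cinner (T x) x = cnj (cinner (T x) x)"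
    using cinner_commute[of "T x" x] selfadjointD[OF assms, of x x] by simp
  then show ?thesis
    by (simp add: complex_eq_iff)
qed

lemma selfadjoint_id: "selfadjoint id_blinfun"
  by (simp add: selfadjoint_def)

lemma selfadjoint_add: "selfadjoint S \<Longrightarrow> selfadjoint T \<Longrightarrow> selfadjoint (S + T)"
  by (simp add: selfadjoint_def cinner_algebra blinfun.add_left)

lemma selfadjoint_scaleR: "selfadjoint T \<Longrightarrow> selfadjoint (c *\<^sub>R T)"
  by (simp add: selfadjoint_def cinner_algebra blinfun.scaleR_left)

lemma selfadjoint_compose:
  assumes "selfadjoint S" "selfadjoint T" "S o\<^sub>L T = T o\<^sub>L S"
  shows "selfadjoint (S o\<^sub>L T)"
  using assms by (metis selfadjoint_def blinfun_apply_blinfun_compose)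

lemma Re_cinner_le: "\<bar>Re (cinner x y)\<bar> \<le> norm x * norm y"
  using abs_Re_le_cmod Cauchy_Schwarz_cinner order_trans by blast

lemma selfadjoint_norm_le:
  assumes S: "selfadjoint S" and "0 \<le> w"
    and w: "\<And>x. \<bar>Re (cinner (S x) x)\<bar> \<le> w * (norm x)\<^sup>2"
  shows "norm S \<le> w"
proof (rule norm_blinfun_bound[OF \<open>0 \<le> w\<close>])
  fix x
  show "norm (S x) \<le> w * norm x"
  proof (cases "S x = 0")
    case True
    then show ?thesis
      using \<open>0 \<le> w\<close> by simp
  next
    case False
    then have Sx: "norm (S x) > 0"
      by simp
    then have x: "norm x > 0"
      by auto
    \<comment> \<open>polarisation in \<open>x\<close> and the vector of length \<open>norm x\<close> in the direction of \<open>S x\<close>\<close>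
    define y where "y = (norm x / norm (S x)) *\<^sub>R S x"
    have ny: "norm y = norm x"
      using Sx by (simp add: y_def)
    have Sxy: "Re (cinner (S x) y) = norm x * norm (S x)"
      using Sx by (simp add: y_def cinner_algebra cinner_self_eq_norm power2_eq_square)
    have "cinner (S y) x = cinner y (S x)"
      by (rule selfadjointD[OF S])
    then have "Re (cinner (S y) x) = Re (cinner (S x) y)"
      by (simp add: Re_cinner_commute[of y])
    then have "4 * Re (cinner (S x) y)
        = Re (cinner (S (x + y)) (x + y)) - Re (cinner (S (x - y)) (x - y))"
      by (simp add: blinfun.add_right blinfun.diff_right cinner_algebra)
    also have "\<dots> \<le> w * (norm (x + y))\<^sup>2 + w * (norm (x - y))\<^sup>2"
      using w[of "x + y"] w[of "x - y"] by argo
    also have "\<dots> = 4 * (w * norm x * norm x)"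
      unfolding norm_add_sq norm_diff_sq ny by (simp add: algebra_simps power2_eq_square)
    finally have "norm x * norm (S x) \<le> norm x * (w * norm x)"
      unfolding Sxy by (simp add: mult_ac)
    then show ?thesis
      using x by simp
  qed
qed

definition bounded_below :: "('a::real_normed_vector \<Rightarrow> 'b::real_normed_vector) \<Rightarrow> bool"
  where "bounded_below F \<longleftrightarrow> (\<exists>c>0. \<forall>x. c * norm x \<le> norm (F x))"

lemma bounded_below_comp:
  assumes "bounded_below F" "bounded_below G"
  shows "bounded_below (\<lambda>x. F (G x))"
proof -
  obtain a b where a: "a > 0" "\<And>x. a * norm x \<le> norm (F x)"
    and b: "b > 0" "\<And>x. b * norm x \<le> norm (G x)"
    using assms by (auto simp: bounded_below_def)
  have "(a * b) * norm x \<le> norm (F (G x))" for x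
    using mult_left_mono[OF b(2)[of x], of a] a(1) a(2)[of "G x"] unfolding mult.assoc by linarith
  then show ?thesis
    using a(1) b(1) unfolding bounded_below_def by (intro exI[of _ "a * b"]) simp
qed

text \<open>
  Along unit vectors \<open>x\<close> with \<open>norm (S x)\<close> tending to \<open>N = norm S\<close>, the square of
  \<open>norm (S (S x) - N\<^sup>2 x)\<close> is at most \<open>2 N\<^sup>2 (N\<^sup>2 - (norm (S x))\<^sup>2)\<close> and so tends to \<open>0\<close>.
  This says that \<open>N\<close> or \<open>- N\<close> is an approximate eigenvalue of \<open>S\<close>.
\<close>

lemma selfadjoint_sq_not_bounded_below:
  fixes S :: "'a::complex_inner \<Rightarrow>\<^sub>L 'a" and x0 :: 'a
  assumes S: "selfadjoint S" and "x0 \<noteq> 0"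
  shows "\<not> bounded_below (\<lambda>x. S (S x) - (norm S)\<^sup>2 *\<^sub>R x)"
proof
  define N where "N = norm S"
  assume "bounded_below (\<lambda>x. S (S x) - (norm S)\<^sup>2 *\<^sub>R x)"
  then obtain c where c: "c > 0" "\<And>x. c * norm x \<le> norm (S (S x) - N\<^sup>2 *\<^sub>R x)"
    by (auto simp: bounded_below_def N_def)
  have N_bound: "norm (S x) \<le> N * norm x" for x
    unfolding N_def by (rule norm_blinfun)
  have "N \<noteq> 0"
  proof
    assume "N = 0"
    then have "c * norm x0 \<le> 0"
      using c(2)[of x0] by (simp add: N_def)
    then show False
      using \<open>x0 \<noteq> 0\<close> \<open>c > 0\<close> by (simp add: mult_le_0_iff)
  qed
  then have "N > 0"
    by (simp add: N_def)
  have key: "2 * N\<^sup>2 * (norm (S x))\<^sup>2 \<le> (2 * N\<^sup>2 * N\<^sup>2 - c\<^sup>2) * (norm x)\<^sup>2" for x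
  proof -
    have "Re (cinner (S (S x)) (N\<^sup>2 *\<^sub>R x)) = N\<^sup>2 * (norm (S x))\<^sup>2"
      by (simp add: cinner_scaleR_right selfadjointD[OF S] norm_sq_cinner flip: of_real_power)
    then have "(norm (S (S x) - N\<^sup>2 *\<^sub>R x))\<^sup>2
        = (norm (S (S x)))\<^sup>2 - 2 * (N\<^sup>2 * (norm (S x))\<^sup>2) + (N\<^sup>2 * norm x)\<^sup>2"
      by (simp add: norm_diff_sq)
    moreover have "(c * norm x)\<^sup>2 \<le> (norm (S (S x) - N\<^sup>2 *\<^sub>R x))\<^sup>2"
      using c by (intro power_mono) auto
    moreover have "norm (S (S x)) \<le> N * (N * norm x)"
      using N_bound[of "S x"] mult_left_mono[OF N_bound[of x], of N] \<open>N > 0\<close> by linarith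
    then have "(norm (S (S x)))\<^sup>2 \<le> (N\<^sup>2 * norm x)\<^sup>2"
      by (intro power_mono) (auto simp: power2_eq_square mult.assoc)
    ultimately have "2 * (N\<^sup>2 * (norm (S x))\<^sup>2) \<le> 2 * (N\<^sup>2 * norm x)\<^sup>2 - (c * norm x)\<^sup>2"
      by linarith
    then show ?thesis
      by (simp add: power_mult_distrib power2_eq_square algebra_simps)
  qed
  define d where "d = (2 * N\<^sup>2 * N\<^sup>2 - c\<^sup>2) / (2 * N\<^sup>2)"
  have S_le: "(norm (S x))\<^sup>2 \<le> d * (norm x)\<^sup>2" for x
    using key[of x] \<open>N > 0\<close> by (simp add: d_def field_simps)
  have "0 \<le> d * (norm x0)\<^sup>2"
    by (rule order_trans[OF _ S_le]) simp
  then have "0 \<le> d"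
    using \<open>x0 \<noteq> 0\<close> by (simp add: zero_le_mult_iff)
  have "norm S \<le> sqrt d"
  proof (rule norm_blinfun_bound)
    show "norm (S x) \<le> sqrt d * norm x" for x
      using real_le_rsqrt[OF S_le[of x]] \<open>0 \<le> d\<close> by (simp add: real_sqrt_mult)
  qed (use \<open>0 \<le> d\<close> in simp)
  then have "N\<^sup>2 \<le> d"
    using \<open>0 \<le> d\<close> \<open>N > 0\<close> unfolding N_def by (metis norm_ge_zero power_mono real_sqrt_pow2)
  then have "2 * N\<^sup>2 * N\<^sup>2 \<le> 2 * N\<^sup>2 * N\<^sup>2 - c\<^sup>2"
    using \<open>N > 0\<close> by (simp add: d_def field_simps)
  then show False
    using \<open>c > 0\<close> by (simp add: power2_eq_square mult_le_0_iff)
qed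

section \<open>Polynomials of an operator and the spectrum\<close>

text \<open>
  The value at \<open>x\<close> of a complex polynomial of \<open>T\<close>, by the Horner scheme. Complex coefficients are
  needed to split a polynomial into linear factors.
\<close>

definition cpoly_vec :: "complex poly \<Rightarrow> ('a::complex_inner \<Rightarrow>\<^sub>L 'a) \<Rightarrow> 'a \<Rightarrow> 'a"
  where "cpoly_vec p T x = fold_coeffs (\<lambda>c y. c *\<^sub>C x + T y) p 0"

lemma cpoly_vec_0 [simp]: "cpoly_vec 0 T x = 0"
  by (simp add: cpoly_vec_def)

lemma cpoly_vec_pCons [simp]: "cpoly_vec (pCons c p) T x = c *\<^sub>C x + T (cpoly_vec p T x)"
  by (cases "p = 0"; cases "c = 0") (auto simp: cpoly_vec_def blinfun.zero_right)

lemma cpoly_vec_add: "cpoly_vec (p + q) T x = cpoly_vec p T x + cpoly_vec q T x"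
  by (induction p q rule: poly_induct2) (simp_all add: scaleC_add_left blinfun.add_right)

lemma cpoly_vec_smult:
  assumes "is_clinear T"
  shows "cpoly_vec (smult c p) T x = c *\<^sub>C cpoly_vec p T x"
  using assms by (induction p) (simp_all add: scaleC_add_right scaleC_scaleC is_clinear_def)

lemma cpoly_vec_linear_factor:
  assumes "is_clinear T"
  shows "cpoly_vec ([:- z, 1:] * p) T x = T (cpoly_vec p T x) - z *\<^sub>C cpoly_vec p T x"
  by (simp add: cpoly_vec_add cpoly_vec_smult[OF assms] scaleC_minus_left
      del: smult_minus_left)

text \<open>
  For non-real \<open>z\<close> the bound comes from \<open>\<langle>T x, x\<rangle>\<close> being real, so that the imaginary part of
  \<open>\<langle>(T - z) x, x\<rangle>\<close> is \<open>- Im z (norm x)\<^sup>2\<close>.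
\<close>

lemma selfadjoint_resolvent_bounded_below:
  assumes T: "selfadjoint T" and z: "z \<notin> op_spectrum T \<or> Im z \<noteq> 0"
  shows "bounded_below (\<lambda>x. T x - z *\<^sub>C x)"
  using z
proof
  assume "z \<notin> op_spectrum T"
  then obtain S where S: "\<And>x. blinfun_apply S (T x - z *\<^sub>C x) = x"
    by (auto simp: op_spectrum_def)
  have "inverse (norm S + 1) * norm x \<le> norm (T x - z *\<^sub>C x)" for x
  proof -
    have "norm x \<le> norm S * norm (T x - z *\<^sub>C x)"
      using norm_blinfun[of S "T x - z *\<^sub>C x"] by (simp add: S)
    also have "\<dots> \<le> (norm S + 1) * norm (T x - z *\<^sub>C x)"
      by (intro mult_right_mono) auto
    finally show ?thesis
      by (simp add: inverse_eq_divide divide_le_eq add_nonneg_pos mult.commute)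
  qed
  then show ?thesis
    unfolding bounded_below_def
    by (intro exI[of _ "inverse (norm S + 1)"]) (simp add: add_nonneg_pos)
next
  assume "Im z \<noteq> 0"
  have "\<bar>Im z\<bar> * norm x \<le> norm (T x - z *\<^sub>C x)" for x
  proof (cases "x = 0")
    case False
    have "\<bar>Im (cinner (T x - z *\<^sub>C x) x)\<bar> = \<bar>Im z\<bar> * (norm x)\<^sup>2"
      by (simp add: cinner_algebra selfadjoint_Im_eq_0[OF T] cinner_self_eq_norm abs_mult
          flip: of_real_power)
    then have "\<bar>Im z\<bar> * (norm x)\<^sup>2 \<le> norm (T x - z *\<^sub>C x) * norm x"
      using abs_Im_le_cmod Cauchy_Schwarz_cinner order_trans by metis
    then show ?thesis
      using False by (simp add: power2_eq_square)
  qed simp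
  then show ?thesis
    using \<open>Im z \<noteq> 0\<close> unfolding bounded_below_def by (intro exI[of _ "\<bar>Im z\<bar>"]) simp
qed

text \<open>
  The polynomial splits into linear factors over the complex numbers, each factor \<open>T - z\<close> is
  bounded below, and composition preserves this.
\<close>

lemma cpoly_vec_bounded_below:
  assumes T: "selfadjoint T" and "q \<noteq> 0"
    and "\<And>t::real. complex_of_real t \<in> op_spectrum T \<Longrightarrow> poly q (complex_of_real t) \<noteq> 0"
  shows "bounded_below (cpoly_vec q T)"
  using assms(2,3)
proof (induction "degree q" arbitrary: q)
  case 0
  then obtain a where "q = [:a:]" "a \<noteq> 0"
    by (metis degree_0_id pCons_0_0)
  then show ?case
    unfolding bounded_below_def
    by (intro exI[of _ "cmod a"]) (simp add: norm_scaleC blinfun.zero_right)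
next
  case (Suc n)
  have "\<not> constant (poly q)"
    using Suc.hyps(2) by (simp add: constant_degree)
  then obtain z where z: "poly q z = 0"
    using fundamental_theorem_of_algebra by blast
  then obtain p where q: "q = [:- z, 1:] * p"
    by (auto simp: poly_eq_0_iff_dvd)
  have "p \<noteq> 0"
    using Suc.prems(1) q by auto
  have "degree q = Suc (degree p)"
    unfolding q using \<open>p \<noteq> 0\<close> by (subst degree_mult_eq) auto
  then have "bounded_below (cpoly_vec p T)"
    using Suc.hyps(1)[of p] Suc.hyps(2) Suc.prems(2) \<open>p \<noteq> 0\<close> unfolding q by auto
  moreover have "z \<notin> op_spectrum T \<or> Im z \<noteq> 0"
    using z Suc.prems(2)[of "Re z"] by (auto simp: complex_is_Real_iff of_real_Re)
  then have "bounded_below (\<lambda>x. T x - z *\<^sub>C x)"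
    by (rule selfadjoint_resolvent_bounded_below[OF T])
  ultimately have "bounded_below (\<lambda>x. T (cpoly_vec p T x) - z *\<^sub>C cpoly_vec p T x)"
    by (rule bounded_below_comp[rotated])
  then show ?case
    unfolding q cpoly_vec_linear_factor[OF selfadjoint_is_clinear[OF T], abs_def] .
qed

lemma poly_op_eq_sum:
  assumes "degree p \<le> n"
  shows "poly_op p T = (\<Sum>i\<le>n. coeff p i *\<^sub>R (((o\<^sub>L) T) ^^ i) id_blinfun)"
  unfolding poly_op_def
  using assms by (intro sum.mono_neutral_left) (auto simp: coeff_eq_0)

lemma poly_op_0 [simp]: "poly_op 0 T = 0"
  by (simp add: poly_op_def)

lemma poly_op_pCons [simp]: "poly_op (pCons c p) T = c *\<^sub>R id_blinfun + (T o\<^sub>L poly_op p T)"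
proof -
  have "poly_op (pCons c p) T
      = (\<Sum>i\<le>Suc (degree p). coeff (pCons c p) i *\<^sub>R (((o\<^sub>L) T) ^^ i) id_blinfun)"
    by (rule poly_op_eq_sum) (simp add: degree_pCons_le)
  also have "\<dots> = c *\<^sub>R id_blinfun
      + (\<Sum>i\<le>degree p. coeff p i *\<^sub>R (T o\<^sub>L (((o\<^sub>L) T) ^^ i) id_blinfun))"
    unfolding sum.atMost_Suc_shift by simp
  also have "\<dots> = c *\<^sub>R id_blinfun + (T o\<^sub>L poly_op p T)"
    unfolding poly_op_def
    by (simp add: bounded_bilinear.sum_right[OF bounded_bilinear_blinfun_compose]
        bounded_bilinear.scaleR_right[OF bounded_bilinear_blinfun_compose])
  finally show ?thesis .
qed

lemmas blinfun_compose_algebra =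
  bounded_bilinear.add_left[OF bounded_bilinear_blinfun_compose]
  bounded_bilinear.add_right[OF bounded_bilinear_blinfun_compose]
  bounded_bilinear.diff_left[OF bounded_bilinear_blinfun_compose]
  bounded_bilinear.diff_right[OF bounded_bilinear_blinfun_compose]
  bounded_bilinear.scaleR_left[OF bounded_bilinear_blinfun_compose]
  bounded_bilinear.scaleR_right[OF bounded_bilinear_blinfun_compose]
  bounded_bilinear.zero_left[OF bounded_bilinear_blinfun_compose]
  bounded_bilinear.zero_right[OF bounded_bilinear_blinfun_compose]

lemma blinfun_compose_id [simp]: "id_blinfun o\<^sub>L T = T" "T o\<^sub>L id_blinfun = T"
  by (auto intro: blinfun_eqI)

lemma blinfun_compose_assoc: "(R o\<^sub>L S) o\<^sub>L T = R o\<^sub>L (S o\<^sub>L T)"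
  by (auto intro: blinfun_eqI)

lemma poly_op_add: "poly_op (p + q) T = poly_op p T + poly_op q T"
  by (induction p q rule: poly_induct2) (simp_all add: blinfun_compose_algebra algebra_simps)

lemma poly_op_smult: "poly_op (smult c p) T = c *\<^sub>R poly_op p T"
  by (induction p) (simp_all add: blinfun_compose_algebra algebra_simps)

lemma poly_op_diff: "poly_op (p - q) T = poly_op p T - poly_op q T"
  using poly_op_add[of p "smult (- 1) q" T] unfolding poly_op_smult by simp

lemma poly_op_mult: "poly_op (p * q) T = poly_op p T o\<^sub>L poly_op q T"
  by (induction p)
    (simp_all add: blinfun_compose_algebra poly_op_add poly_op_smult blinfun_compose_assoc)

lemma poly_op_pcompose: "poly_op (pcompose p q) T = poly_op p (poly_op q T)"
  by (induction p) (simp_all add: pcompose_pCons poly_op_add poly_op_mult blinfun_compose_algebra)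

lemma poly_op_commute: "T o\<^sub>L poly_op p T = poly_op p T o\<^sub>L T"
  using poly_op_mult[of "[:0, 1:]" p T] poly_op_mult[of p "[:0, 1:]" T]
  by (simp add: mult.commute blinfun_compose_algebra)

lemma selfadjoint_poly_op:
  assumes "selfadjoint T"
  shows "selfadjoint (poly_op p T)"
proof (induction p)
  case 0
  show ?case
    by (simp add: selfadjoint_def)
next
  case (pCons c p)
  then show ?case
    unfolding poly_op_pCons
    by (intro selfadjoint_add selfadjoint_scaleR selfadjoint_id selfadjoint_compose assms
        poly_op_commute)
qed

lemma poly_op_apply: "poly_op p T x = cpoly_vec (map_poly complex_of_real p) T x"
  by (induction p)
    (simp_all add: map_poly_pCons blinfun.add_left blinfun.scaleR_left scaleR_eq_scaleC)

lemma poly_map_of_real: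
  "poly (map_poly complex_of_real p) (complex_of_real t) = complex_of_real (poly p t)"
  by (induction p) (simp_all add: map_poly_pCons)

lemma selfadjoint_poly_root_in_spectrum:
  fixes T :: "'a::complex_inner \<Rightarrow>\<^sub>L 'a"
  assumes T: "selfadjoint T" and "q \<noteq> 0"
    and "\<not> bounded_below (poly_op q T)"
  obtains t :: real where "complex_of_real t \<in> op_spectrum T" "poly q t = 0"
proof -
  define Q where "Q = map_poly complex_of_real q"
  have "Q \<noteq> 0"
    using \<open>q \<noteq> 0\<close> by (simp add: Q_def map_poly_eq_0_iff)
  moreover have "\<not> bounded_below (cpoly_vec Q T)"
    using assms(3) by (simp add: Q_def poly_op_apply[abs_def])
  ultimately obtain t :: real
    where "complex_of_real t \<in> op_spectrum T" "poly Q (complex_of_real t) = 0"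
    using cpoly_vec_bounded_below[OF T] by blast
  then show thesis
    using that by (simp add: Q_def poly_map_of_real)
qed

text \<open>
  This is the special case of the spectral radius formula that the functional calculus needs. With
  \<open>N = norm (poly_op p T)\<close>, the operator \<open>p(T)\<^sup>2 - N\<^sup>2\<close> is not bounded below, so some linear factor
  of the polynomial \<open>p\<^sup>2 - N\<^sup>2\<close> vanishes at a point of the spectrum.
\<close>

lemma norm_poly_op_attained:
  fixes T :: "'a::complex_inner \<Rightarrow>\<^sub>L 'a" and x0 :: 'a
  assumes T: "selfadjoint T" and "x0 \<noteq> 0"
  obtains t where "complex_of_real t \<in> op_spectrum T" "\<bar>poly p t\<bar> = norm (poly_op p T)"
proof -
  have root: "\<exists>t::real. complex_of_real t \<in> op_spectrum T \<and> (poly p t)\<^sup>2 = (norm (poly_op p T))\<^sup>2"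
    if "p * p - [:(norm (poly_op p T))\<^sup>2:] \<noteq> 0" for p
  proof -
    define S where "S = poly_op p T"
    define q where "q = p * p - [:(norm S)\<^sup>2:]"
    have "blinfun_apply (poly_op q T) = (\<lambda>x. S (S x) - (norm S)\<^sup>2 *\<^sub>R x)"
      by (rule ext) (simp add: q_def S_def poly_op_diff poly_op_mult blinfun.diff_left
          blinfun.add_left blinfun.scaleR_left blinfun_compose_algebra)
    then have "\<not> bounded_below (poly_op q T)"
      using selfadjoint_sq_not_bounded_below[OF selfadjoint_poly_op[OF T] \<open>x0 \<noteq> 0\<close>, of p]
      by (simp add: S_def)
    moreover have "q \<noteq> 0"
      using that by (simp add: q_def S_def)
    ultimately obtain t :: real where "complex_of_real t \<in> op_spectrum T" "poly q t = 0"
      using selfadjoint_poly_root_in_spectrum[OF T] by blast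
    then show ?thesis
      by (auto simp: q_def S_def power2_eq_square)
  qed
  have "\<exists>t::real. complex_of_real t \<in> op_spectrum T \<and> (poly p t)\<^sup>2 = (norm (poly_op p T))\<^sup>2"
  proof (cases "p * p - [:(norm (poly_op p T))\<^sup>2:] = 0")
    case True
    \<comment> \<open>then \<open>p\<close> is constant, and any point of the spectrum will do\<close>
    have "(poly p t)\<^sup>2 = (norm (poly_op p T))\<^sup>2" for t
      using arg_cong[OF True, of "\<lambda>q. poly q t"] by (simp add: power2_eq_square)
    moreover have "[:0, 1::real:] * [:0, 1:] - [:(norm (poly_op [:0, 1:] T))\<^sup>2:] \<noteq> 0"
      by simp
    ultimately show ?thesis
      using root by blast
  next
    case False
    then show ?thesis
      by (rule root)
  qed
  then show thesis
    using that by (metis abs_norm_cancel power2_eq_iff abs_minus_cancel)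
qed

lemma norm_poly_op_le:
  assumes "selfadjoint T" and "0 \<le> B"
    and "\<And>t. complex_of_real t \<in> op_spectrum T \<Longrightarrow> \<bar>poly p t\<bar> \<le> B"
  shows "norm (poly_op p T) \<le> B"
proof (cases "\<exists>x0::'a. x0 \<noteq> 0")
  case True
  then show ?thesis
    using norm_poly_op_attained[OF assms(1)] assms(3) by metis
next
  case False
  then have "poly_op p T = 0"
    by (metis blinfun_eqI)
  then show ?thesis
    using assms(2) by simp
qed

text \<open>
  For \<open>t\<close> outside the disc, \<open>T - t = (T - m) - (t - m)\<close> is inverted by solving \<open>x = (D x - y) / s\<close>, with
  \<open>D = T - m\<close> and \<open>s = t - m\<close>, by contraction.
\<close>

lemma op_spectrum_disc:
  fixes T :: "'a::chilbert_space \<Rightarrow>\<^sub>L 'a"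
  assumes T: "is_clinear T" and t: "complex_of_real t \<in> op_spectrum T"
  shows "\<bar>t - m\<bar> \<le> norm (T - m *\<^sub>R id_blinfun)"
proof (rule ccontr)
  define D where "D = T - m *\<^sub>R id_blinfun"
  define s where "s = t - m"
  assume "\<not> ?thesis"
  then have Ds: "norm D < \<bar>s\<bar>"
    by (simp add: D_def s_def)
  then have s: "\<bar>s\<bar> > 0"
    using norm_ge_zero[of D] by linarith
  have resolvent: "T x - complex_of_real t *\<^sub>C x = D x - s *\<^sub>R x" for x
    by (simp add: D_def s_def blinfun.diff_left blinfun.scaleR_left scaleR_eq_scaleC[symmetric]
        algebra_simps)
  have "\<exists>!x. (1 / s) *\<^sub>R (D x - y) = x" for y
  proof (rule banach_fix_type[of "norm D / \<bar>s\<bar>"])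
    show "0 \<le> norm D / \<bar>s\<bar>" "norm D / \<bar>s\<bar> < 1"
      using Ds s by auto
    have "dist ((1 / s) *\<^sub>R (D x - y)) ((1 / s) *\<^sub>R (D x' - y)) \<le> norm D / \<bar>s\<bar> * dist x x'"
      for x x'
    proof -
      have "(1 / s) *\<^sub>R (D x - y) - (1 / s) *\<^sub>R (D x' - y) = (1 / s) *\<^sub>R D (x - x')"
        by (simp add: blinfun.diff_right algebra_simps)
      then show ?thesis
        using norm_blinfun[of D "x - x'"] s by (simp add: dist_norm divide_right_mono)
    qed
    then show "\<forall>x x'. dist ((1 / s) *\<^sub>R (D x - y)) ((1 / s) *\<^sub>R (D x' - y))
        \<le> norm D / \<bar>s\<bar> * dist x x'"
      by blast
  qed
  moreover have "(1 / s) *\<^sub>R (D x - y) = x \<longleftrightarrow> D x - s *\<^sub>R x = y" for x y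
  proof -
    have "(1 / s) *\<^sub>R (D x - y) = x \<longleftrightarrow> s *\<^sub>R ((1 / s) *\<^sub>R (D x - y)) = s *\<^sub>R x"
      using s by (simp only: scaleR_cancel_left) simp
    also have "\<dots> \<longleftrightarrow> D x - y = s *\<^sub>R x"
      using s by simp
    finally show ?thesis
      by (auto simp: algebra_simps)
  qed
  ultimately have ex1: "\<exists>!x. D x - s *\<^sub>R x = y" for y
    by simp
  then obtain S where S: "\<And>y. D (S y) - s *\<^sub>R S y = y"
    by metis
  have S_eqI: "S y = x" if "D x - s *\<^sub>R x = y" for x y
    using ex1[of y] S[of y] that by blast
  have D_clinear: "D (c *\<^sub>C x) = c *\<^sub>C D x" for c x
    using T by (simp add: D_def is_clinear_def blinfun.diff_left blinfun.scaleR_left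
        scaleC_diff_right scaleR_eq_scaleC scaleC_scaleC mult.commute)
  have S_scaleC: "S (c *\<^sub>C y) = c *\<^sub>C S y" for c y
  proof (rule S_eqI)
    have "D (c *\<^sub>C S y) - s *\<^sub>R (c *\<^sub>C S y) = c *\<^sub>C (D (S y) - s *\<^sub>R S y)"
      by (simp add: D_clinear scaleC_diff_right scaleR_eq_scaleC scaleC_scaleC mult.commute)
    then show "D (c *\<^sub>C S y) - s *\<^sub>R (c *\<^sub>C S y) = c *\<^sub>C y"
      by (simp add: S)
  qed
  have "bounded_linear S"
  proof (rule bounded_linear_intro)
    show "S (x + y) = S x + S y" for x y
    proof (rule S_eqI)
      have "D (S x + S y) - s *\<^sub>R (S x + S y) = (D (S x) - s *\<^sub>R S x) + (D (S y) - s *\<^sub>R S y)"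
        by (simp add: blinfun.add_right algebra_simps)
      then show "D (S x + S y) - s *\<^sub>R (S x + S y) = x + y"
        by (simp add: S)
    qed
    show "S (c *\<^sub>R x) = c *\<^sub>R S x" for c x
      by (simp add: scaleR_eq_scaleC S_scaleC)
    show "norm (S y) \<le> norm y * (1 / (\<bar>s\<bar> - norm D))" for y
    proof -
      have "\<bar>s\<bar> * norm (S y) = norm (D (S y) - y)"
        using S[of y] by (metis diff_diff_eq2 add_diff_cancel_left' norm_scaleR)
      also have "\<dots> \<le> norm D * norm (S y) + norm y"
        by (rule order_trans[OF norm_triangle_ineq4 add_right_mono[OF norm_blinfun]])
      finally show ?thesis
        using Ds by (simp add: field_simps)
    qed
  qed
  then have "blinfun_apply (Blinfun S) = S"
    by (rule bounded_linear_Blinfun_apply)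
  then have "is_clinear (Blinfun S)" "\<And>x. Blinfun S (T x - complex_of_real t *\<^sub>C x) = x"
    "\<And>x. T (Blinfun S x) - complex_of_real t *\<^sub>C Blinfun S x = x"
    by (simp_all add: is_clinear_def S_scaleC resolvent S S_eqI)
  then have "complex_of_real t \<notin> op_spectrum T"
    unfolding op_spectrum_def by blast
  then show False
    using t by blast
qed

section \<open>Positive operators\<close>

definition positive_op :: "('a::complex_inner \<Rightarrow>\<^sub>L 'a) \<Rightarrow> bool"
  where "positive_op T \<longleftrightarrow> selfadjoint T \<and> (\<forall>x. 0 \<le> Re (cinner (T x) x))"

text \<open>
  Since \<open>\<langle>T x, x\<rangle>\<close> lies between \<open>0\<close> and \<open>M (norm x)\<^sup>2\<close>, the norm of \<open>T - M / 2\<close> is at most \<open>M / 2\<close>,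
  and both bounds on the spectrum follow from a single disc around \<open>M / 2\<close>.
\<close>

lemma positive_op_spectrum:
  fixes T :: "'a::chilbert_space \<Rightarrow>\<^sub>L 'a"
  assumes T: "positive_op T" and M: "norm T \<le> M"
    and t: "complex_of_real t \<in> op_spectrum T"
  shows "t \<in> {0..M}"
proof -
  have sa: "selfadjoint T" and pos: "\<And>x. 0 \<le> Re (cinner (T x) x)"
    using T by (auto simp: positive_op_def)
  have "0 \<le> M"
    using M norm_ge_zero order_trans by blast
  have "norm (T - (M / 2) *\<^sub>R id_blinfun) \<le> M / 2"
  proof (rule selfadjoint_norm_le)
    have "selfadjoint (T + (- (M / 2)) *\<^sub>R id_blinfun)"
      by (intro selfadjoint_add selfadjoint_scaleR selfadjoint_id sa)
    then show "selfadjoint (T - (M / 2) *\<^sub>R id_blinfun)"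
      by simp
    show "0 \<le> M / 2"
      using \<open>0 \<le> M\<close> by simp
    fix x
    have "Re (cinner (T x) x) \<le> norm (T x) * norm x"
      using Re_cinner_le[of "T x" x] by linarith
    also have "norm (T x) \<le> M * norm x"
      using norm_blinfun[of T x] M by (meson mult_right_mono norm_ge_zero order_trans)
    then have "norm (T x) * norm x \<le> (M * norm x) * norm x"
      by (rule mult_right_mono) simp
    finally have "Re (cinner (T x) x) \<le> M * (norm x)\<^sup>2"
      by (simp add: power2_eq_square)
    moreover have "Re (cinner ((T - (M / 2) *\<^sub>R id_blinfun) x) x)
        = Re (cinner (T x) x) - M / 2 * (norm x)\<^sup>2"
      by (simp add: blinfun.diff_left blinfun.scaleR_left cinner_algebra norm_sq_cinner)
    ultimately show "\<bar>Re (cinner ((T - (M / 2) *\<^sub>R id_blinfun) x) x)\<bar> \<le> M / 2 * (norm x)\<^sup>2"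
      using pos[of x] unfolding abs_le_iff by linarith
  qed
  then have "\<bar>t - M / 2\<bar> \<le> M / 2"
    using op_spectrum_disc[OF selfadjoint_is_clinear[OF sa] t, of "M / 2"] by linarith
  then show ?thesis
    unfolding abs_le_iff by auto
qed

section \<open>The continuous functional calculus of a positive operator\<close>

lemma polynomial_approximation:
  assumes "continuous_on {0..M::real} f"
  obtains p :: "nat \<Rightarrow> real poly"
  where "uniform_limit {0..M} (\<lambda>n. poly (p n)) f sequentially"
proof -
  have "\<exists>p. \<forall>t\<in>{0..M}. \<bar>f t - poly p t\<bar> < 1 / real (Suc n)" for n
  proof -
    obtain g where g: "real_polynomial_function g"
      "\<And>t. t \<in> {0..M} \<Longrightarrow> \<bar>f t - g t\<bar> < 1 / real (Suc n)"
      by (rule Stone_Weierstrass_real_polynomial_function[OF compact_Icc assms, of "1 / real (Suc n)"])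
        auto
    obtain a k where "g = (\<lambda>t. \<Sum>i\<le>k. a i * t ^ i)"
      using g(1) by (auto simp: real_polynomial_function_iff_sum)
    then have "poly (\<Sum>i\<le>k. monom (a i) i) t = g t" for t
      by (simp add: poly_sum poly_monom)
    then show ?thesis
      using g(2) by metis
  qed
  then obtain p where p: "\<And>n t. t \<in> {0..M} \<Longrightarrow> \<bar>f t - poly (p n) t\<bar> < 1 / real (Suc n)"
    by metis
  have "uniform_limit {0..M} (\<lambda>n. poly (p n)) f sequentially"
    unfolding uniform_limit_iff
  proof (intro allI impI)
    fix e :: real
    assume "e > 0"
    then have "\<forall>\<^sub>F n in sequentially. 1 / real (Suc n) < e"
      using order_tendstoD(2)[OF LIMSEQ_Suc[OF lim_1_over_n]] by simp
    then show "\<forall>\<^sub>F n in sequentially. \<forall>t\<in>{0..M}. dist (poly (p n) t) (f t) < e"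
    proof (rule eventually_mono, intro ballI)
      fix n t
      assume "1 / real (Suc n) < e" "t \<in> {0..M}"
      then show "dist (poly (p n) t) (f t) < e"
        using p[of t n] by (simp add: dist_real_def abs_minus_commute)
    qed
  qed
  then show thesis
    by (rule that)
qed

text \<open>
  The description operator in \<^const>\<open>cont_fun_calc\<close> denotes: polynomials that are
  uniformly close on the spectrum have close values at \<open>T\<close> (\<open>norm_poly_op_le\<close>), so the values at
  \<open>T\<close> of any approximating sequence form a Cauchy sequence whose limit depends on \<open>f\<close> only. The
  interval may be larger than \<open>[0, norm T]\<close>, so that two operators can share one sequence.
\<close>

lemma poly_op_tendsto_cont_fun_calc:
  fixes T :: "'a::chilbert_space \<Rightarrow>\<^sub>L 'a"
  assumes T: "positive_op T" and M: "norm T \<le> M" and f: "continuous_on {0..M} f"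
    and p: "uniform_limit {0..M} (\<lambda>n. poly (p n)) f sequentially"
  shows "(\<lambda>n. poly_op (p n) T) \<longlonglongrightarrow> cont_fun_calc f T"
proof -
  define \<sigma> where "\<sigma> = {t. complex_of_real t \<in> op_spectrum T}"
  have sa: "selfadjoint T"
    using T by (simp add: positive_op_def)
  have \<sigma>: "\<sigma> \<subseteq> {0..M}"
    using positive_op_spectrum[OF T M] by (auto simp: \<sigma>_def)
  have close: "norm (poly_op q T - poly_op q' T) \<le> 2 * e"
    if "e > 0" "\<forall>t\<in>\<sigma>. dist (poly q t) (f t) < e" "\<forall>t\<in>\<sigma>. dist (poly q' t) (f t) < e" for q q' e
  proof -
    have "norm (poly_op (q - q') T) \<le> 2 * e"
    proof (rule norm_poly_op_le[OF sa])
      fix t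
      assume "complex_of_real t \<in> op_spectrum T"
      then have "dist (poly q t) (f t) < e" "dist (poly q' t) (f t) < e"
        using that by (auto simp: \<sigma>_def)
      then show "\<bar>poly (q - q') t\<bar> \<le> 2 * e"
        unfolding poly_diff dist_real_def by linarith
    qed (use that in simp)
    then show ?thesis
      by (simp add: poly_op_diff)
  qed
  obtain q0 where "uniform_limit {0..M} (\<lambda>n. poly (q0 n)) f sequentially"
    using polynomial_approximation[OF f] .
  then have q0: "uniform_limit \<sigma> (\<lambda>n. poly (q0 n)) f sequentially"
    using \<sigma> by (rule uniform_limit_on_subset)
  have "Cauchy (\<lambda>n. poly_op (q0 n) T)"
  proof (rule metric_CauchyI)
    fix e :: real
    assume "e > 0"
    then obtain N where N: "\<forall>n\<ge>N. \<forall>t\<in>\<sigma>. dist (poly (q0 n) t) (f t) < e / 3"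
      using q0 unfolding uniform_limit_iff eventually_sequentially
      by (metis divide_pos_pos zero_less_numeral)
    have "dist (poly_op (q0 m) T) (poly_op (q0 n) T) < e" if "m \<ge> N" "n \<ge> N" for m n
      using close[of "e / 3" "q0 m" "q0 n"] N that \<open>e > 0\<close> by (simp add: dist_norm)
    then show "\<exists>N. \<forall>m\<ge>N. \<forall>n\<ge>N. dist (poly_op (q0 m) T) (poly_op (q0 n) T) < e"
      by blast
  qed
  then obtain S where S: "(\<lambda>n. poly_op (q0 n) T) \<longlonglongrightarrow> S"
    by (auto simp: Cauchy_convergent_iff convergent_def)
  have lim: "(\<lambda>n. poly_op (q n) T) \<longlonglongrightarrow> S"
    if q: "uniform_limit \<sigma> (\<lambda>n. poly (q n)) f sequentially" for q
  proof -
    have "(\<lambda>n. poly_op (q n) T - poly_op (q0 n) T) \<longlonglongrightarrow> 0"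
    proof (rule tendstoI)
      fix e :: real
      assume "e > 0"
      then have "e / 3 > 0"
        by simp
      then have "\<forall>\<^sub>F n in sequentially. (\<forall>t\<in>\<sigma>. dist (poly (q n) t) (f t) < e / 3)
          \<and> (\<forall>t\<in>\<sigma>. dist (poly (q0 n) t) (f t) < e / 3)"
        using q q0 unfolding uniform_limit_iff by (intro eventually_conj) blast+
      then show "\<forall>\<^sub>F n in sequentially. dist (poly_op (q n) T - poly_op (q0 n) T) 0 < e"
      proof (rule eventually_mono)
        fix n
        assume "(\<forall>t\<in>\<sigma>. dist (poly (q n) t) (f t) < e / 3)
          \<and> (\<forall>t\<in>\<sigma>. dist (poly (q0 n) t) (f t) < e / 3)"
        then have "norm (poly_op (q n) T - poly_op (q0 n) T) \<le> 2 * (e / 3)"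
          using close[OF \<open>e / 3 > 0\<close>] by blast
        then show "dist (poly_op (q n) T - poly_op (q0 n) T) 0 < e"
          using \<open>e > 0\<close> by simp
      qed
    qed
    from tendsto_add[OF this S] show ?thesis
      by simp
  qed
  have "cont_fun_calc f T = S"
    unfolding cont_fun_calc_def \<sigma>_def[symmetric]
  proof (rule the_equality)
    show "\<forall>p. uniform_limit \<sigma> (\<lambda>n. poly (p n)) f sequentially \<longrightarrow> (\<lambda>n. poly_op (p n) T) \<longlonglongrightarrow> S"
      using lim by blast
    show "S' = S" if "\<forall>p. uniform_limit \<sigma> (\<lambda>n. poly (p n)) f sequentially
        \<longrightarrow> (\<lambda>n. poly_op (p n) T) \<longlonglongrightarrow> S'" for S'
      using that q0 S LIMSEQ_unique by blast
  qed
  moreover have "uniform_limit \<sigma> (\<lambda>n. poly (p n)) f sequentially"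
    using p \<sigma> by (rule uniform_limit_on_subset)
  ultimately show ?thesis
    using lim by simp
qed

lemma cont_fun_calc_approximation:
  fixes T :: "'a::chilbert_space \<Rightarrow>\<^sub>L 'a"
  assumes "positive_op T" and "continuous_on {0..} f"
  obtains p where "uniform_limit {0..norm T} (\<lambda>n. poly (p n)) f sequentially"
    and "(\<lambda>n. poly_op (p n) T) \<longlonglongrightarrow> cont_fun_calc f T"
proof -
  have f: "continuous_on {0..norm T} f"
    by (rule continuous_on_subset[OF assms(2)]) auto
  obtain p where "uniform_limit {0..norm T} (\<lambda>n. poly (p n)) f sequentially"
    using polynomial_approximation[OF f] .
  then show thesis
    using poly_op_tendsto_cont_fun_calc[OF assms(1) order_refl f] that by blast
qed

context
  fixes T :: "'a::chilbert_space \<Rightarrow>\<^sub>L 'a"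
  assumes T: "positive_op T"
begin

lemma cont_fun_calc_eqI:
  assumes "continuous_on {0..} f"
    and "uniform_limit {0..norm T} (\<lambda>n. poly (p n)) f sequentially"
    and "(\<lambda>n. poly_op (p n) T) \<longlonglongrightarrow> S"
  shows "cont_fun_calc f T = S"
proof -
  have "continuous_on {0..norm T} f"
    by (rule continuous_on_subset[OF assms(1)]) auto
  then have "(\<lambda>n. poly_op (p n) T) \<longlonglongrightarrow> cont_fun_calc f T"
    using poly_op_tendsto_cont_fun_calc[OF T order_refl] assms(2) by blast
  then show ?thesis
    using assms(3) LIMSEQ_unique by blast
qed

lemma cont_fun_calc_poly: "cont_fun_calc (poly p) T = poly_op p T"
proof (rule cont_fun_calc_eqI)
  show "continuous_on {0..} (poly p)"
    by (intro continuous_intros)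
  show "uniform_limit {0..norm T} (\<lambda>_. poly p) (poly p) sequentially"
    by (rule uniform_limit_const)
  show "(\<lambda>_. poly_op p T) \<longlonglongrightarrow> poly_op p T"
    by (rule tendsto_const)
qed

lemma cont_fun_calc_cong:
  assumes f: "continuous_on {0..} f" and fg: "\<And>t. t \<ge> 0 \<Longrightarrow> f t = g t"
  shows "cont_fun_calc f T = cont_fun_calc g T"
proof -
  obtain p where p: "uniform_limit {0..norm T} (\<lambda>n. poly (p n)) g sequentially"
    "(\<lambda>n. poly_op (p n) T) \<longlonglongrightarrow> cont_fun_calc g T"
    using cont_fun_calc_approximation[OF T, of g] f fg continuous_on_cong[of "{0..}" "{0..}" f g]
    by auto
  moreover have "uniform_limit {0..norm T} (\<lambda>n. poly (p n)) f sequentially"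
    using p(1) fg by (subst uniform_limit_cong'[of _ _ "\<lambda>n. poly (p n)" _ g]) auto
  ultimately show ?thesis
    using cont_fun_calc_eqI[OF f] by blast
qed

lemma cont_fun_calc_add:
  assumes f: "continuous_on {0..} f" and g: "continuous_on {0..} g"
  shows "cont_fun_calc (\<lambda>t. f t + g t) T = cont_fun_calc f T + cont_fun_calc g T"
proof -
  obtain p where p: "uniform_limit {0..norm T} (\<lambda>n. poly (p n)) f sequentially"
    "(\<lambda>n. poly_op (p n) T) \<longlonglongrightarrow> cont_fun_calc f T"
    using cont_fun_calc_approximation[OF T f] .
  obtain q where q: "uniform_limit {0..norm T} (\<lambda>n. poly (q n)) g sequentially"
    "(\<lambda>n. poly_op (q n) T) \<longlonglongrightarrow> cont_fun_calc g T"
    using cont_fun_calc_approximation[OF T g] .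
  show ?thesis
  proof (rule cont_fun_calc_eqI)
    show "continuous_on {0..} (\<lambda>t. f t + g t)"
      by (intro continuous_intros f g)
    show "uniform_limit {0..norm T} (\<lambda>n. poly (p n + q n)) (\<lambda>t. f t + g t) sequentially"
      unfolding poly_add by (intro uniform_limit_add p q)
    show "(\<lambda>n. poly_op (p n + q n) T) \<longlonglongrightarrow> cont_fun_calc f T + cont_fun_calc g T"
      unfolding poly_op_add by (intro tendsto_add p q)
  qed
qed

lemma cont_fun_calc_mult:
  assumes f: "continuous_on {0..} f" and g: "continuous_on {0..} g"
  shows "cont_fun_calc (\<lambda>t. f t * g t) T = cont_fun_calc f T o\<^sub>L cont_fun_calc g T"
proof -
  obtain p where p: "uniform_limit {0..norm T} (\<lambda>n. poly (p n)) f sequentially"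
    "(\<lambda>n. poly_op (p n) T) \<longlonglongrightarrow> cont_fun_calc f T"
    using cont_fun_calc_approximation[OF T f] .
  obtain q where q: "uniform_limit {0..norm T} (\<lambda>n. poly (q n)) g sequentially"
    "(\<lambda>n. poly_op (q n) T) \<longlonglongrightarrow> cont_fun_calc g T"
    using cont_fun_calc_approximation[OF T g] .
  have bdd: "bounded (h ` {0..norm T})" if "continuous_on {0..} h" for h :: "real \<Rightarrow> real"
    by (intro compact_imp_bounded compact_continuous_image continuous_on_subset[OF that]) auto
  show ?thesis
  proof (rule cont_fun_calc_eqI)
    show "continuous_on {0..} (\<lambda>t. f t * g t)"
      by (intro continuous_intros f g)
    show "uniform_limit {0..norm T} (\<lambda>n. poly (p n * q n)) (\<lambda>t. f t * g t) sequentially"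
      unfolding poly_mult by (intro uniform_lim_mult p q bdd f g)
    show "(\<lambda>n. poly_op (p n * q n) T) \<longlonglongrightarrow> (cont_fun_calc f T o\<^sub>L cont_fun_calc g T)"
      unfolding poly_op_mult
      by (intro bounded_bilinear.tendsto[OF bounded_bilinear_blinfun_compose] p q)
  qed
qed

lemma cont_fun_calc_const: "cont_fun_calc (\<lambda>_. c) T = c *\<^sub>R id_blinfun"
proof -
  have "(\<lambda>_. c) = poly [:c:]"
    by auto
  then show ?thesis
    by (simp only: cont_fun_calc_poly) (simp add: blinfun_compose_algebra)
qed

lemma selfadjoint_cont_fun_calc:
  assumes "continuous_on {0..} f"
  shows "selfadjoint (cont_fun_calc f T)"
  unfolding selfadjoint_def
proof (intro allI)
  fix x y
  obtain p where "(\<lambda>n. poly_op (p n) T) \<longlonglongrightarrow> cont_fun_calc f T"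
    using cont_fun_calc_approximation[OF T assms] by blast
  then have lim: "(\<lambda>n. poly_op (p n) T z) \<longlonglongrightarrow> cont_fun_calc f T z" for z
    by (intro blinfun.tendsto tendsto_const)
  have "selfadjoint (poly_op (p n) T)" for n
    using T by (simp add: positive_op_def selfadjoint_poly_op)
  then have "cinner (poly_op (p n) T x) y = cinner x (poly_op (p n) T y)" for n
    by (rule selfadjointD)
  moreover have "(\<lambda>n. cinner (poly_op (p n) T x) y) \<longlonglongrightarrow> cinner (cont_fun_calc f T x) y"
    "(\<lambda>n. cinner x (poly_op (p n) T y)) \<longlonglongrightarrow> cinner x (cont_fun_calc f T y)"
    by (intro tendsto_cinner lim tendsto_const)+
  ultimately show "cinner (cont_fun_calc f T x) y = cinner x (cont_fun_calc f T y)"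
    using LIMSEQ_unique by simp
qed

lemma norm_cont_fun_calc_sq:
  assumes f: "continuous_on {0..} f"
  shows "(norm (cont_fun_calc f T x))\<^sup>2 = Re (cinner (cont_fun_calc (\<lambda>t. f t * f t) T x) x)"
proof -
  have "(norm (cont_fun_calc f T x))\<^sup>2 = Re (cinner (cont_fun_calc f T (cont_fun_calc f T x)) x)"
    unfolding norm_sq_cinner selfadjointD[OF selfadjoint_cont_fun_calc[OF f], symmetric]
    by (simp add: selfadjointD[OF selfadjoint_cont_fun_calc[OF f]])
  then show ?thesis
    by (simp add: cont_fun_calc_mult[OF f f])
qed

lemma positive_op_cont_fun_calc:
  assumes f: "continuous_on {0..} f" and "\<And>t. t \<ge> 0 \<Longrightarrow> f t \<ge> 0"
  shows "positive_op (cont_fun_calc f T)"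
  unfolding positive_op_def
proof (intro conjI allI)
  show "selfadjoint (cont_fun_calc f T)"
    by (rule selfadjoint_cont_fun_calc[OF f])
  show "0 \<le> Re (cinner (cont_fun_calc f T x) x)" for x
  proof -
    have "continuous_on {0..} (\<lambda>t. sqrt (f t))"
      by (intro continuous_intros f)
    then have "Re (cinner (cont_fun_calc (\<lambda>t. sqrt (f t) * sqrt (f t)) T x) x) \<ge> 0"
      using norm_cont_fun_calc_sq[of "\<lambda>t. sqrt (f t)" x] zero_le_power2 by metis
    moreover have "cont_fun_calc f T = cont_fun_calc (\<lambda>t. sqrt (f t) * sqrt (f t)) T"
      using assms by (intro cont_fun_calc_cong) auto
    ultimately show ?thesis
      by simp
  qed
qed

lemma cont_fun_calc_mono:
  assumes f: "continuous_on {0..} f" and g: "continuous_on {0..} g"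
    and le: "\<And>t. t \<ge> 0 \<Longrightarrow> f t \<le> g t"
  shows "Re (cinner (cont_fun_calc f T x) x) \<le> Re (cinner (cont_fun_calc g T x) x)"
proof -
  have d: "continuous_on {0..} (\<lambda>t. g t - f t)"
    by (intro continuous_intros f g)
  have "cont_fun_calc g T = cont_fun_calc f T + cont_fun_calc (\<lambda>t. g t - f t) T"
    using cont_fun_calc_add[OF f d] by simp
  moreover have "0 \<le> Re (cinner (cont_fun_calc (\<lambda>t. g t - f t) T x) x)"
    using positive_op_cont_fun_calc[OF d] le by (simp add: positive_op_def)
  ultimately show ?thesis
    by (simp add: blinfun.add_left cinner_add_left)
qed

lemma norm_cont_fun_calc_mono:
  assumes f: "continuous_on {0..} f" and g: "continuous_on {0..} g"
    and le: "\<And>t. t \<ge> 0 \<Longrightarrow> \<bar>f t\<bar> \<le> \<bar>g t\<bar>"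
  shows "norm (cont_fun_calc f T x) \<le> norm (cont_fun_calc g T x)"
proof (rule power2_le_imp_le)
  have "f t * f t \<le> g t * g t" if "t \<ge> 0" for t
    using le[OF that] abs_le_square_iff[of "f t" "g t"] by (simp add: power2_eq_square)
  then show "(norm (cont_fun_calc f T x))\<^sup>2 \<le> (norm (cont_fun_calc g T x))\<^sup>2"
    unfolding norm_cont_fun_calc_sq[OF f] norm_cont_fun_calc_sq[OF g]
    by (intro cont_fun_calc_mono continuous_intros f g)
qed simp

end

text \<open>
  An even polynomial \<open>q(t\<^sup>2)\<close> intertwines as the hypothesis lets \<open>A\<close> be moved past \<open>B\<^sup>2\<close> and
  \<open>C\<^sup>2\<close>, and such polynomials approximate every continuous \<open>f\<close> on \<open>[0, \<infinity>)\<close> locally uniformly,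
  since \<open>f t = f (sqrt (t\<^sup>2))\<close>.
\<close>

lemma cont_fun_calc_intertwine:
  fixes A B C :: "'a::chilbert_space \<Rightarrow>\<^sub>L 'a"
  assumes B: "positive_op B" and C: "positive_op C"
    and sq: "A o\<^sub>L (B o\<^sub>L B) = (C o\<^sub>L C) o\<^sub>L A"
    and f: "continuous_on {0..} f"
  shows "A o\<^sub>L cont_fun_calc f B = cont_fun_calc f C o\<^sub>L A"
proof -
  define M where "M = max (norm B) (norm C)"
  have "continuous_on {0..M\<^sup>2} (\<lambda>s. f (sqrt s))"
    by (rule continuous_on_compose2[OF f]) (auto intro!: continuous_intros)
  then obtain q where q: "uniform_limit {0..M\<^sup>2} (\<lambda>n. poly (q n)) (\<lambda>s. f (sqrt s)) sequentially"
    by (rule polynomial_approximation)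
  define r where "r n = pcompose (q n) [:0, 0, 1:]" for n
  have r: "uniform_limit {0..M} (\<lambda>n. poly (r n)) f sequentially"
    unfolding uniform_limit_iff
  proof (intro allI impI)
    fix e :: real
    assume "e > 0"
    then have "\<forall>\<^sub>F n in sequentially. \<forall>s\<in>{0..M\<^sup>2}. dist (poly (q n) s) (f (sqrt s)) < e"
      using q by (simp add: uniform_limit_iff)
    then show "\<forall>\<^sub>F n in sequentially. \<forall>t\<in>{0..M}. dist (poly (r n) t) (f t) < e"
    proof (rule eventually_mono, intro ballI)
      fix n t
      assume *: "\<forall>s\<in>{0..M\<^sup>2}. dist (poly (q n) s) (f (sqrt s)) < e" and t: "t \<in> {0..M}"
      have "t\<^sup>2 \<in> {0..M\<^sup>2}"
        using t by (auto intro: power_mono)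
      with * have "dist (poly (q n) (t\<^sup>2)) (f (sqrt (t\<^sup>2))) < e"
        by blast
      then show "dist (poly (r n) t) (f t) < e"
        using t by (simp add: r_def poly_pcompose power2_eq_square)
    qed
  qed
  have f': "continuous_on {0..M} f"
    by (rule continuous_on_subset[OF f]) auto
  have lim: "(\<lambda>n. poly_op (r n) B) \<longlonglongrightarrow> cont_fun_calc f B"
    "(\<lambda>n. poly_op (r n) C) \<longlonglongrightarrow> cont_fun_calc f C"
    by (rule poly_op_tendsto_cont_fun_calc[OF _ _ f' r]; simp add: B C M_def)+
  have "A o\<^sub>L poly_op p (B o\<^sub>L B) = poly_op p (C o\<^sub>L C) o\<^sub>L A" for p
  proof (induction p)
    case (pCons c p)
    have "A o\<^sub>L ((B o\<^sub>L B) o\<^sub>L poly_op p (B o\<^sub>L B)) = (C o\<^sub>L C) o\<^sub>L (A o\<^sub>L poly_op p (B o\<^sub>L B))"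
      by (metis sq blinfun_compose_assoc)
    then show ?case
      by (simp add: blinfun_compose_algebra pCons.IH blinfun_compose_assoc)
  qed (simp add: blinfun_compose_algebra)
  then have "A o\<^sub>L poly_op (r n) B = poly_op (r n) C o\<^sub>L A" for n
    by (simp add: r_def poly_op_pcompose blinfun_compose_algebra)
  moreover have "(\<lambda>n. A o\<^sub>L poly_op (r n) B) \<longlonglongrightarrow> (A o\<^sub>L cont_fun_calc f B)"
    "(\<lambda>n. poly_op (r n) C o\<^sub>L A) \<longlonglongrightarrow> (cont_fun_calc f C o\<^sub>L A)"
    by (intro bounded_bilinear.tendsto[OF bounded_bilinear_blinfun_compose] lim tendsto_const)+
  ultimately show ?thesis
    using LIMSEQ_unique by simp
qed

section \<open>Powers and the absolute value\<close>

definition nonneg_powr :: "real \<Rightarrow> real \<Rightarrow> real"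
  where "nonneg_powr a t = (if a = 0 then 1 else t powr a)"

lemma op_powr_eq: "op_powr P a = cont_fun_calc (nonneg_powr a) P"
  by (simp add: op_powr_def nonneg_powr_def[abs_def])

lemma continuous_on_nonneg_powr:
  assumes "0 \<le> a"
  shows "continuous_on {0..} (nonneg_powr a)"
proof (cases "a = 0")
  case False
  then have "continuous_on {0..} (\<lambda>t. t powr a)"
    using assms by (intro continuous_on_powr' continuous_intros) auto
  then show ?thesis
    using False by (simp add: nonneg_powr_def[abs_def])
qed (simp add: nonneg_powr_def[abs_def])

lemma nonneg_powr_nonneg [simp]: "0 \<le> nonneg_powr a t"
  by (simp add: nonneg_powr_def)

lemma nonneg_powr_add:
  assumes "0 \<le> a" "0 \<le> b"
  shows "nonneg_powr (a + b) t = nonneg_powr a t * nonneg_powr b t"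
  using assms by (auto simp: nonneg_powr_def powr_add add_nonneg_eq_0_iff)

lemma nonneg_powr_1: "0 \<le> t \<Longrightarrow> nonneg_powr 1 t = t"
  by (simp add: nonneg_powr_def)

lemma nonneg_powr_mult:
  assumes "0 < b"
  shows "nonneg_powr (a * b) t = nonneg_powr a t powr b"
  using assms by (simp add: nonneg_powr_def powr_powr)

context
  fixes P :: "'a::chilbert_space \<Rightarrow>\<^sub>L 'a"
  assumes P: "positive_op P"
begin

lemma op_powr_add:
  assumes "0 \<le> a" "0 \<le> b"
  shows "op_powr P (a + b) = op_powr P a o\<^sub>L op_powr P b"
  unfolding op_powr_eq cont_fun_calc_mult[OF P continuous_on_nonneg_powr[OF assms(1)]
      continuous_on_nonneg_powr[OF assms(2)], symmetric]
  using assms by (intro cont_fun_calc_cong[OF P] continuous_on_nonneg_powr)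
    (auto simp: nonneg_powr_add)

lemma op_powr_1: "op_powr P 1 = P"
proof -
  have "op_powr P 1 = cont_fun_calc (poly [:0, 1:]) P"
    unfolding op_powr_eq
    by (intro cont_fun_calc_cong[OF P] continuous_on_nonneg_powr) (auto simp: nonneg_powr_1)
  also have "\<dots> = P"
    unfolding cont_fun_calc_poly[OF P] by (simp add: blinfun_compose_algebra)
  finally show ?thesis .
qed

lemma positive_op_powr:
  assumes "0 \<le> a"
  shows "positive_op (op_powr P a)"
  unfolding op_powr_eq
  by (intro positive_op_cont_fun_calc[OF P] continuous_on_nonneg_powr assms) simp

lemma norm_op_powr_sq:
  assumes "0 \<le> a"
  shows "(norm (op_powr P a x))\<^sup>2 = Re (cinner (op_powr P (2 * a) x) x)"
proof -
  have "cinner (op_powr P a x) (op_powr P a x) = cinner (op_powr P a (op_powr P a x)) x"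
    using positive_op_powr[OF assms] selfadjointD[of "op_powr P a" "op_powr P a x" x]
    by (simp add: positive_op_def)
  then show ?thesis
    using op_powr_add[OF assms assms] by (simp add: norm_sq_cinner)
qed

text \<open>
  Jensen's inequality for the convex function \<open>s powr r\<close> and the spectral distribution of
  \<open>P powr a\<close> at \<open>x\<close>, whose mean is \<open>m = \<langle>P powr a x, x\<rangle>\<close>. The tangent line at \<open>m\<close> lies below the
  function, and monotonicity of the functional calculus carries this over to quadratic forms.
\<close>

lemma McCarthy_inequality:
  assumes "0 \<le> a" "1 \<le> r" "norm x = 1"
  shows "Re (cinner (op_powr P a x) x) powr r \<le> Re (cinner (op_powr P (a * r) x) x)"
proof -
  define m where "m = Re (cinner (op_powr P a x) x)"
  have ar: "0 \<le> a * r"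
    using assms by simp
  have "0 \<le> m"
    using positive_op_powr[OF assms(1)] by (simp add: m_def positive_op_def)
  show ?thesis
  proof (cases "m = 0")
    case True
    then show ?thesis
      using positive_op_powr[OF ar] by (simp add: positive_op_def flip: m_def)
  next
    case False
    then have m: "m > 0"
      using \<open>0 \<le> m\<close> by simp
    define k where "k = r * m powr (r - 1)"
    define l where "l = m powr r - k * m"
    \<comment> \<open>\<open>s = 0\<close> is apart because convexity is used on the open half-line only\<close>
    have tangent: "l + k * s \<le> s powr r" if "0 \<le> s" for s
    proof (cases "s = 0")
      case True
      have "k * m = r * m powr r"
        using m by (simp add: k_def powr_diff)
      moreover have "m powr r \<le> r * m powr r"
        using assms(2) by (simp add: mult_le_cancel_right1)
      ultimately show ?thesis
        using True by (simp add: l_def)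
    next
      case False
      have "s powr r - m powr r \<ge> k * (s - m)"
      proof (rule convex_on_imp_above_tangent[OF powr_convex[OF assms(2)]])
        show "connected {0::real<..}" "m \<in> interior {0<..}" "s \<in> {0<..}"
          using m False that by (auto simp: interior_open)
        show "((\<lambda>s. s powr r) has_real_derivative k) (at m within {0<..})"
          unfolding k_def by (rule has_field_derivative_at_within[OF has_real_derivative_powr[OF m]])
      qed
      then show ?thesis
        by (simp add: l_def algebra_simps)
    qed
    have pa: "continuous_on {0..} (nonneg_powr a)"
      by (rule continuous_on_nonneg_powr[OF assms(1)])
    have ka: "continuous_on {0..} (\<lambda>t. k * nonneg_powr a t)"
      by (intro continuous_intros pa)
    have "cont_fun_calc (\<lambda>t. l + k * nonneg_powr a t) P = l *\<^sub>R id_blinfun + k *\<^sub>R op_powr P a"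
      using cont_fun_calc_add[OF P continuous_on_const ka, of l]
        cont_fun_calc_mult[OF P continuous_on_const pa, of k]
      by (simp add: cont_fun_calc_const[OF P] op_powr_eq blinfun_compose_algebra)
    then have "Re (cinner (cont_fun_calc (\<lambda>t. l + k * nonneg_powr a t) P x) x) = l + k * m"
      using assms(3) by (simp add: blinfun.add_left blinfun.scaleR_left cinner_algebra
          cinner_self_eq_norm m_def)
    moreover have "l + k * nonneg_powr a t \<le> nonneg_powr (a * r) t" if "0 \<le> t" for t
      using tangent[OF nonneg_powr_nonneg] nonneg_powr_mult[of r a t] assms(2) by simp
    then have "Re (cinner (cont_fun_calc (\<lambda>t. l + k * nonneg_powr a t) P x) x)
        \<le> Re (cinner (op_powr P (a * r) x) x)"
      unfolding op_powr_eq
      by (intro cont_fun_calc_mono[OF P] continuous_on_nonneg_powr[OF ar] continuous_intros ka) auto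
    ultimately show ?thesis
      by (simp add: l_def flip: m_def)
  qed
qed

end

lemma positive_op_adjoint_compose:
  assumes "is_clinear A"
  shows "positive_op (adjoint_op A o\<^sub>L A)"
  using assms
  by (auto simp: positive_op_def selfadjoint_def cinner_adjoint' cinner_adjoint[symmetric]
      simp flip: norm_sq_cinner)

lemma positive_op_abs:
  assumes "is_clinear A"
  shows "positive_op (op_abs A)"
  unfolding op_abs_def by (intro positive_op_powr positive_op_adjoint_compose assms) simp

lemma op_abs_sq:
  assumes "is_clinear A"
  shows "op_abs A o\<^sub>L op_abs A = adjoint_op A o\<^sub>L A"
  using op_powr_add[OF positive_op_adjoint_compose[OF assms], of "1/2" "1/2"]
    op_powr_1[OF positive_op_adjoint_compose[OF assms]]
  by (simp add: op_abs_def)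

lemma norm_op_abs:
  assumes "is_clinear A"
  shows "norm (op_abs A x) = norm (A x)"
proof -
  have "cinner (op_abs A x) (op_abs A x) = cinner ((op_abs A o\<^sub>L op_abs A) x) x"
    using positive_op_abs[OF assms] by (simp add: positive_op_def selfadjointD)
  also have "\<dots> = cinner (A x) (A x)"
    by (simp add: op_abs_sq[OF assms] cinner_adjoint'[OF assms])
  finally have "(norm (op_abs A x))\<^sup>2 = (norm (A x))\<^sup>2"
    by (simp add: norm_sq_cinner)
  then show ?thesis
    by simp
qed

text \<open>
  For \<open>\<epsilon> > 0\<close>, the operator \<open>A\<close> differs from \<open>A g(B)\<close>, where \<open>g t = t / (t + \<epsilon>)\<close>, by an operator
  of norm at most \<open>\<epsilon>\<close>. Now \<open>g t = h t * t powr \<theta>\<close> with \<open>h t = t powr (1 - \<theta>) / (t + \<epsilon>)\<close>. Applying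
  \<open>B powr \<theta>\<close> to \<open>x\<close> and moving \<open>h\<close> through \<open>A\<close> to the other side of the inner product leaves
  \<open>A\<^sup>* h(C) y\<close>, whose norm is that of \<open>C h(C) y\<close>; and \<open>t * h t \<le> t powr (1 - \<theta>)\<close>.
\<close>

lemma mixed_Schwarz:
  fixes A :: "'a::chilbert_space \<Rightarrow>\<^sub>L 'a"
  assumes A: "is_clinear A" and \<theta>: "0 \<le> \<theta>" "\<theta> \<le> 1"
  shows "cmod (cinner (A x) y)
    \<le> norm (op_powr (op_abs A) \<theta> x) * norm (op_powr (op_abs (adjoint_op A)) (1 - \<theta>) y)"
proof -
  define B where "B = op_abs A"
  define C where "C = op_abs (adjoint_op A)"
  have A': "is_clinear (adjoint_op A)"
    by (rule is_clinear_adjoint[OF A])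
  have B: "positive_op B" and C: "positive_op C"
    by (simp_all add: B_def C_def positive_op_abs A A')
  have "C o\<^sub>L C = A o\<^sub>L adjoint_op A"
    unfolding C_def op_abs_sq[OF A'] adjoint_adjoint[OF A] ..
  then have sq: "A o\<^sub>L (B o\<^sub>L B) = (C o\<^sub>L C) o\<^sub>L A"
    unfolding B_def op_abs_sq[OF A] by (simp add: blinfun_compose_assoc)
  define u where "u = op_powr B \<theta> x"
  define v where "v = op_powr C (1 - \<theta>) y"
  have main: "cmod (cinner (A x) y) \<le> \<epsilon> * (norm x * norm y) + norm u * norm v" if \<epsilon>: "\<epsilon> > 0" for \<epsilon>
  proof -
    have nz: "t + \<epsilon> \<noteq> 0" if "t \<ge> 0" for t
      using that \<epsilon> by linarith
    define g where "g t = t / (t + \<epsilon>)" for t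
    define e where "e t = \<epsilon> / (t + \<epsilon>)" for t
    define h where "h t = nonneg_powr (1 - \<theta>) t / (t + \<epsilon>)" for t
    have p1: "continuous_on {0..} (nonneg_powr (1 - \<theta>))"
      and p2: "continuous_on {0..} (nonneg_powr \<theta>)"
      using \<theta> by (auto intro: continuous_on_nonneg_powr)
    have g: "continuous_on {0..} g" and e: "continuous_on {0..} e" and h: "continuous_on {0..} h"
      unfolding g_def e_def h_def using nz by (auto intro!: continuous_intros p1)
    have th: "continuous_on {0..} (\<lambda>t. t * h t)" and te: "continuous_on {0..} (\<lambda>t. t * e t)"
      by (intro continuous_intros h e)+
    have id_eq: "cont_fun_calc (\<lambda>t. t) P = P" if "positive_op P" for P :: "'a \<Rightarrow>\<^sub>L 'a"
      using cont_fun_calc_cong[OF that continuous_on_id nonneg_powr_1[symmetric]] op_powr_1[OF that]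
      by (simp add: op_powr_eq)
    have one: "cont_fun_calc g B + cont_fun_calc e B = id_blinfun"
    proof -
      have "cont_fun_calc g B + cont_fun_calc e B = cont_fun_calc (\<lambda>t. g t + e t) B"
        by (rule cont_fun_calc_add[OF B g e, symmetric])
      also have "\<dots> = cont_fun_calc (\<lambda>_. 1) B"
      proof (rule cont_fun_calc_cong[OF B])
        show "continuous_on {0..} (\<lambda>t. g t + e t)"
          by (intro continuous_intros g e)
        show "g t + e t = 1" if "t \<ge> 0" for t
          using nz[OF that] by (simp add: g_def e_def flip: add_divide_distrib)
      qed
      finally show ?thesis
        by (simp add: cont_fun_calc_const[OF B])
    qed
    have "cont_fun_calc g B = cont_fun_calc (\<lambda>t. h t * nonneg_powr \<theta> t) B"
    proof (rule cont_fun_calc_cong[OF B g])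
      show "g t = h t * nonneg_powr \<theta> t" if "t \<ge> 0" for t
        using nonneg_powr_add[of "1 - \<theta>" \<theta> t] \<theta> that by (simp add: g_def h_def nonneg_powr_1)
    qed
    then have "cont_fun_calc g B x = cont_fun_calc h B u"
      by (simp add: cont_fun_calc_mult[OF B h p2] u_def op_powr_eq)
    then have x_eq: "x = cont_fun_calc h B u + cont_fun_calc e B x"
      using arg_cong[OF one, of "\<lambda>T. blinfun_apply T x"] by (simp add: blinfun.add_left)
    have "norm (A (cont_fun_calc e B x)) = norm (B (cont_fun_calc e B x))"
      by (simp add: B_def norm_op_abs[OF A])
    also have "\<dots> = norm (cont_fun_calc (\<lambda>t. t * e t) B x)"
      using cont_fun_calc_mult[OF B continuous_on_id e] by (simp add: id_eq[OF B])
    also have "\<dots> \<le> norm (cont_fun_calc (\<lambda>_. \<epsilon>) B x)"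
    proof (rule norm_cont_fun_calc_mono[OF B te continuous_on_const])
      show "\<bar>t * e t\<bar> \<le> \<bar>\<epsilon>\<bar>" if "t \<ge> 0" for t
        using that \<epsilon> by (simp add: e_def divide_le_eq)
    qed
    also have "\<dots> = \<epsilon> * norm x"
      using \<epsilon> by (simp add: cont_fun_calc_const[OF B] blinfun.scaleR_left)
    finally have err: "cmod (cinner (A (cont_fun_calc e B x)) y) \<le> (\<epsilon> * norm x) * norm y"
      using Cauchy_Schwarz_cinner mult_right_mono norm_ge_zero order_trans by metis
    have "norm (adjoint_op A (cont_fun_calc h C y)) = norm (C (cont_fun_calc h C y))"
      by (simp add: C_def norm_op_abs[OF A'])
    also have "\<dots> = norm (cont_fun_calc (\<lambda>t. t * h t) C y)"
      using cont_fun_calc_mult[OF C continuous_on_id h] by (simp add: id_eq[OF C])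
    also have "\<dots> \<le> norm v"
      unfolding v_def op_powr_eq
    proof (rule norm_cont_fun_calc_mono[OF C th p1])
      show "\<bar>t * h t\<bar> \<le> \<bar>nonneg_powr (1 - \<theta>) t\<bar>" if "t \<ge> 0" for t
        using that \<epsilon> by (simp add: h_def divide_le_eq mult.commute[of "nonneg_powr _ _"]
            mult_right_mono)
    qed
    finally have hv: "norm (adjoint_op A (cont_fun_calc h C y)) \<le> norm v" .
    have "A (cont_fun_calc h B u) = cont_fun_calc h C (A u)"
      using arg_cong[OF cont_fun_calc_intertwine[OF B C sq h], of "\<lambda>T. blinfun_apply T u"] by simp
    then have "cinner (A (cont_fun_calc h B u)) y = cinner u (adjoint_op A (cont_fun_calc h C y))"
      by (simp add: selfadjointD[OF selfadjoint_cont_fun_calc[OF C h]] cinner_adjoint[OF A])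
    then have "cmod (cinner (A (cont_fun_calc h B u)) y) \<le> norm u * norm v"
      using Cauchy_Schwarz_cinner mult_left_mono[OF hv norm_ge_zero] order_trans by metis
    moreover have "cinner (A x) y
        = cinner (A (cont_fun_calc h B u)) y + cinner (A (cont_fun_calc e B x)) y"
      using arg_cong[OF x_eq, of "blinfun_apply A"] by (simp add: blinfun.add_right cinner_add_left)
    then have "cmod (cinner (A x) y)
        \<le> cmod (cinner (A (cont_fun_calc h B u)) y) + cmod (cinner (A (cont_fun_calc e B x)) y)"
      by (simp add: norm_triangle_ineq)
    ultimately show ?thesis
      using err by (simp add: mult.assoc)
  qed
  have "((\<lambda>\<epsilon>. \<epsilon> * (norm x * norm y) + norm u * norm v)
      \<longlongrightarrow> 0 * (norm x * norm y) + norm u * norm v) (at_right 0)"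
    by (intro tendsto_intros)
  then have "cmod (cinner (A x) y) \<le> 0 * (norm x * norm y) + norm u * norm v"
  proof (rule tendsto_lowerbound)
    show "\<forall>\<^sub>F \<epsilon> in at_right 0. cmod (cinner (A x) y) \<le> \<epsilon> * (norm x * norm y) + norm u * norm v"
      using main by (auto simp: eventually_at_filter)
  qed simp
  then show ?thesis
    by (simp add: u_def v_def B_def C_def)
qed

section \<open>The numerical radius\<close>

lemma bdd_above_numerical_range:
  fixes T :: "'a::complex_inner \<Rightarrow>\<^sub>L 'a"
  shows "bdd_above (insert 0 {cmod (cinner (T x) x) | x. norm x = 1})"
proof (rule bdd_aboveI[of _ "norm T"])
  fix s
  assume "s \<in> insert 0 {cmod (cinner (T x) x) | x. norm x = 1}"
  then consider "s = 0" | x where "norm x = 1" "s = cmod (cinner (T x) x)"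
    by auto
  then show "s \<le> norm T"
  proof cases
    case 2
    then show ?thesis
      using Cauchy_Schwarz_cinner[of "T x" x] norm_blinfun[of T x] by simp
  qed simp
qed

lemma numerical_radius_ge:
  fixes T :: "'a::complex_inner \<Rightarrow>\<^sub>L 'a"
  shows "norm x = 1 \<Longrightarrow> cmod (cinner (T x) x) \<le> numerical_radius T"
  unfolding numerical_radius_def by (intro cSup_upper bdd_above_numerical_range) auto

lemma numerical_radius_nonneg:
  fixes T :: "'a::complex_inner \<Rightarrow>\<^sub>L 'a"
  shows "0 \<le> numerical_radius T"
  unfolding numerical_radius_def by (intro cSup_upper bdd_above_numerical_range) simp

lemma numerical_radius_powr_le:
  fixes T :: "'a::complex_inner \<Rightarrow>\<^sub>L 'a"
  assumes "0 < s" "0 \<le> K" and le: "\<And>x. norm x = 1 \<Longrightarrow> cmod (cinner (T x) x) powr s \<le> K"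
  shows "numerical_radius T powr s \<le> K"
proof -
  have "c \<le> K powr (1 / s)" if "0 \<le> c" "c powr s \<le> K" for c
    using powr_mono2[of "1 / s" "c powr s" K] that assms(1) by (simp add: powr_powr)
  then have "numerical_radius T \<le> K powr (1 / s)"
    unfolding numerical_radius_def by (intro cSup_least) (auto simp: le)
  then have "numerical_radius T powr s \<le> (K powr (1 / s)) powr s"
    using assms(1) by (intro powr_mono2) (auto simp: numerical_radius_nonneg)
  then show ?thesis
    using assms(1,2) by (simp add: powr_powr)
qed

theorem theorem2p1:
  fixes A :: "'a::chilbert_space \<Rightarrow>\<^sub>L 'a" and r \<theta> :: real
  assumes "is_clinear A"
    and "r \<ge> 1"
    and "0 \<le> \<theta>" and "\<theta> \<le> 1"
  shows "numerical_radius A powr (2 * r) \<le>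
    1 / 4 * norm (op_powr (op_abs A) (4 * r * \<theta>)
                  + op_powr (op_abs (adjoint_op A)) (4 * r * (1 - \<theta>)))
    + 1 / 2 * numerical_radius
        (op_powr (op_abs A) (2 * r * \<theta>) o\<^sub>L op_powr (op_abs (adjoint_op A)) (2 * r * (1 - \<theta>)))"
    (is "_ \<le> 1 / 4 * norm ?Q + 1 / 2 * numerical_radius ?R")
proof (rule numerical_radius_powr_le)
  define B where "B = op_abs A"
  define C where "C = op_abs (adjoint_op A)"
  have B: "positive_op B" and C: "positive_op C"
    using assms(1) by (simp_all add: B_def C_def positive_op_abs is_clinear_adjoint)
  show "0 < 2 * r" "0 \<le> 1 / 4 * norm ?Q + 1 / 2 * numerical_radius ?R"
    using assms(2) numerical_radius_nonneg[of ?R] by auto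
  fix x :: 'a
  assume x: "norm x = 1"
  define a where "a = op_powr B (2 * r * \<theta>) x"
  define b where "b = op_powr C (2 * r * (1 - \<theta>)) x"
  have nn: "0 \<le> 2 * r * \<theta>" "0 \<le> 2 * r * (1 - \<theta>)"
    using assms by auto
  have saB: "selfadjoint (op_powr B (2 * r * \<theta>))"
    and a: "0 \<le> Re (cinner a x)" and b: "0 \<le> Re (cinner b x)"
    using positive_op_powr[OF B nn(1)] positive_op_powr[OF C nn(2)]
    by (simp_all add: positive_op_def a_def b_def)
  have powr_2r: "c powr (2 * r) = c\<^sup>2 powr r" if "0 \<le> c" for c :: real
    using powr_powr[of c 2 r] that by simp
  have "cmod (cinner (A x) x) powr (2 * r)
      \<le> (norm (op_powr B \<theta> x) * norm (op_powr C (1 - \<theta>) x)) powr (2 * r)"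
    using mixed_Schwarz[OF assms(1,3,4)] assms(2) by (intro powr_mono2) (auto simp: B_def C_def)
  also have "\<dots> = (norm (op_powr B \<theta> x))\<^sup>2 powr r * (norm (op_powr C (1 - \<theta>) x))\<^sup>2 powr r"
    by (simp add: powr_mult powr_2r del: powr_numeral)
  also have "\<dots> \<le> Re (cinner a x) * Re (cinner b x)"
  proof (rule mult_mono)
    show "(norm (op_powr B \<theta> x))\<^sup>2 powr r \<le> Re (cinner a x)"
      using McCarthy_inequality[OF B _ assms(2) x, of "2 * \<theta>"] assms(3)
      by (simp add: norm_op_powr_sq[OF B] a_def mult_ac)
    show "(norm (op_powr C (1 - \<theta>) x))\<^sup>2 powr r \<le> Re (cinner b x)"
      using McCarthy_inequality[OF C _ assms(2) x, of "2 * (1 - \<theta>)"] assms(4)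
      by (simp add: norm_op_powr_sq[OF C] b_def mult_ac)
  qed (use a in simp_all)
  also have "Re (cinner a x) * Re (cinner b x) \<le> cmod (cinner a x) * cmod (cinner x b)"
  proof -
    have "Re (cinner b x) \<le> cmod (cinner x b)"
      using complex_Re_le_cmod[of "cinner x b"] Re_cinner_commute[of b x] by simp
    then show ?thesis
      using b by (intro mult_mono complex_Re_le_cmod) auto
  qed
  also have "\<dots> \<le> (norm a * norm b + cmod (cinner a b)) / 2"
    by (rule Buzano_inequality[OF x])
  also have "\<dots> \<le> 1 / 4 * norm ?Q + 1 / 2 * numerical_radius ?R"
  proof -
    have "(norm a)\<^sup>2 = Re (cinner (op_powr B (4 * r * \<theta>) x) x)"
      using norm_op_powr_sq[OF B nn(1), of x] by (simp add: a_def mult.assoc)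
    moreover have "(norm b)\<^sup>2 = Re (cinner (op_powr C (4 * r * (1 - \<theta>)) x) x)"
      using norm_op_powr_sq[OF C nn(2), of x] by (simp add: b_def mult.assoc)
    ultimately have "(norm a)\<^sup>2 + (norm b)\<^sup>2 = Re (cinner (?Q x) x)"
      by (simp add: B_def C_def blinfun.add_left cinner_add_left)
    also have "\<dots> \<le> norm ?Q"
      using Re_cinner_le[of "?Q x" x] norm_blinfun[of ?Q x] x by simp
    finally have "norm a * norm b \<le> norm ?Q / 2"
      using sum_squares_bound[of "norm a" "norm b"] by simp
    moreover have "cinner b a = cinner (?R x) x"
      using selfadjointD[OF saB, of b x] by (simp add: a_def b_def B_def C_def)
    then have "cmod (cinner a b) \<le> numerical_radius ?R"
      using numerical_radius_ge[OF x, of ?R] cinner_commute[of a b] by simp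
    ultimately show ?thesis
      by simp
  qed
  finally show "cmod (cinner (A x) x) powr (2 * r)
      \<le> 1 / 4 * norm ?Q + 1 / 2 * numerical_radius ?R" .
qed

end
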